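(* Let $p>1$, $\alpha\ge 0$, and let $\{S_t=u_tC_{\phi_t} : t\in\,]0,1[\}$ be an admissible family of weighted composition operators on $A^p_\alpha$ with direction $\xi\in\partial\mathbb D$. Then for every $t\in\,]0,1[$, $$\sup_{(f_n)\in W_0(\partial B_{A^p_\alpha})}\limsup_n\|S_tf_n\|_{A^p_\alpha}\le\lim_c\|S_tf_{c,\xi}\|_{A^p_\alpha}.$$
   Context: $\mathbb D$ is the open unit disk in $\mathbb C$, $\mathcal H(\mathbb D)$ the holomorphic functions on $\mathbb D$, $B(z,r)$ the open disk with center $z$ and radius $r$, $dA(x+iy)=dx\,dy/\pi$, $dA_\alpha(z)=(1+\alpha)(1-|z|^2)^\alpha dA(z)$. For $p>1$, $\alpha\ge0$, $A^p_\alpha=\{f\in\mathcal H(\mathbb D):\|f\|^p_{A^p_\alpha}=\int_{\mathbb D}|f|^p\,dA_\alpha<\infty\}$. $\mathcal L(X)$ denotes the bounded linear operators on $X$, $\partial B_X$ the unit sphere, and $W_0(\partial B_X)$ the set of weakly null sequences in $\partial B_X$. For holomorphic $\phi_t:\mathbb D\to\mathbb D$ and $u_t\in A^p_\alpha$, $S_t=u_tC_{\phi_t}:A^p_\alpha\to A^p_\alpha$, $f\mapsto u_t\,(f\circ\phi_t)$. The family $\{u_tC_{\phi_t}:t\in\,]0,1[\}$ has direction $\xi\in\partial\mathbb D$ if for every $t\in\,]0,1[$: (a) $\phi_t\in\mathcal H(\mathbb D)$ and $\phi_t'$ extends continuously to $\overline{\mathbb D}\cap B(\xi,\epsilon)$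 for some $\epsilon=\epsilon(t)>0$; (b) $\phi_t(\xi)=\xi$; (c) $\overline{\phi_t(\mathbb D\setminus B(\xi,\epsilon))}\cap\partial\mathbb D=\emptyset$ for every $\epsilon>0$; (d) for every $\epsilon>0$ the set $\overline{\phi_t(B(\xi,\epsilon)\cap\mathbb D)}$ contains a horocycle touching $\xi$ (a circle in $\overline{\mathbb D}$ internally tangent to $\partial\mathbb D$ at $\xi$); (e) $u_t$ extends continuously to $\overline{\mathbb D}\cap B(\xi,\epsilon)$ for some $\epsilon=\epsilon(t)>0$. Values of $\phi_t,\phi_t',u_t$ at $\xi$ are those of the continuous extensions; one has $\phi_t'(\xi)>0$. The family is admissible (with direction $\xi$) if it has direction $\xi$, $\int_0^1\|S_t\|_{\mathcal L(A^p_\alpha)}\,dt<\infty$, and for every $t_0\in\,]0,1[$: (i) $\lim_{t\to t_0}\sup_{z\in\mathbb D}|\phi_t(z)-\phi_{t_0}(z)|=0$; (ii) for every $\epsilon'>0$, $\lim_{t\to t_0}\int_{\mathbb D\setminus B(\xi,\epsilon')}|u_t-u_{t_0}|^p\,dA_\alpha=0$; (iii) for some $\epsilon'>0$, $\sup_{|t-t_0|<\epsilon'}\sup_{z\in B(\xi,\epsilon')\cap\mathbb D}|u_t(z)|<\infty$; (iv) for some $\epsilon'>0$, $\inf_{|t-t_0|<\epsilon'}\inf_{z\in B(\xi,\epsilon')\cap\mathbb D}|\phi_t'(z)|>0$. For $c<(2+\alpha)/p$, $f_{c,\xi}=\hat f_{c,\xi}/\|\hat f_{c,\xi}\|_{A^p_\alpha}$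 with $\hat f_{c,\xi}(z)=(\xi-z)^{-c}$ (a holomorphic branch on $\mathbb D$), and $\lim_c$ denotes the limit along sequences $c=c_n<(2+\alpha)/p$ with $c_n\to(2+\alpha)/p$. *)

theory Defs
  imports "HOL-Complex_Analysis.Complex_Analysis"
begin

section \<open>Weighted Bergman spaces on the unit disk\<close>

abbreviation unit_disk :: "complex set" ("\<D>") where
  "\<D> \<equiv> ball 0 1"

definition dA :: "real \<Rightarrow> complex measure" where
  "dA \<alpha> = density (restrict_space lborel \<D>)
             (\<lambda>z. ennreal ((1 + \<alpha>) * (1 - (cmod z)\<^sup>2) powr \<alpha> / pi))"

text \<open>Elements of the Bergman space are total functions of which only the values on the disk
  matter; two functions agreeing on the disk represent the same element.\<close>

definition bergman :: "real \<Rightarrow> real \<Rightarrow> (complex \<Rightarrow> complex) set" where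
  "bergman p \<alpha> = {f. f holomorphic_on \<D> \<and> integrable (dA \<alpha>) (\<lambda>z. cmod (f z) powr p)}"

definition bergman_norm :: "real \<Rightarrow> real \<Rightarrow> (complex \<Rightarrow> complex) \<Rightarrow> real" where
  "bergman_norm p \<alpha> f = (LINT z|dA \<alpha>. cmod (f z) powr p) powr (1 / p)"

text \<open>Boundedness forces functionals and operators to respect the identification of functions
  that agree on the disk.\<close>

definition bergman_dual :: "real \<Rightarrow> real \<Rightarrow> ((complex \<Rightarrow> complex) \<Rightarrow> complex) set" where
  "bergman_dual p \<alpha> = {\<Lambda>.
     (\<forall>f\<in>bergman p \<alpha>. \<forall>g\<in>bergman p \<alpha>. \<Lambda> (\<lambda>z. f z + g z) = \<Lambda> f + \<Lambda> g) \<and>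
     (\<forall>f\<in>bergman p \<alpha>. \<forall>a. \<Lambda> (\<lambda>z. a * f z) = a * \<Lambda> f) \<and>
     (\<exists>C. \<forall>f\<in>bergman p \<alpha>. cmod (\<Lambda> f) \<le> C * bergman_norm p \<alpha> f)}"

definition bergman_ops ::
    "real \<Rightarrow> real \<Rightarrow> ((complex \<Rightarrow> complex) \<Rightarrow> (complex \<Rightarrow> complex)) set" where
  "bergman_ops p \<alpha> = {T.
     (\<forall>f\<in>bergman p \<alpha>. T f \<in> bergman p \<alpha>) \<and>
     (\<forall>f\<in>bergman p \<alpha>. \<forall>g\<in>bergman p \<alpha>. \<forall>z\<in>\<D>. T (\<lambda>w. f w + g w) z = T f z + T g z) \<and>
     (\<forall>f\<in>bergman p \<alpha>. \<forall>a. \<forall>z\<in>\<D>. T (\<lambda>w. a * f w) z = a * T f z) \<and>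
     (\<exists>C. \<forall>f\<in>bergman p \<alpha>. bergman_norm p \<alpha> (T f) \<le> C * bergman_norm p \<alpha> f)}"

definition bergman_opnorm ::
    "real \<Rightarrow> real \<Rightarrow> ((complex \<Rightarrow> complex) \<Rightarrow> (complex \<Rightarrow> complex)) \<Rightarrow> real" where
  "bergman_opnorm p \<alpha> T =
     (SUP f\<in>{f\<in>bergman p \<alpha>. bergman_norm p \<alpha> f \<le> 1}. bergman_norm p \<alpha> (T f))"

definition weakly_null_unit_seqs :: "real \<Rightarrow> real \<Rightarrow> (nat \<Rightarrow> complex \<Rightarrow> complex) set" where
  "weakly_null_unit_seqs p \<alpha> = {f.
     (\<forall>n. f n \<in> bergman p \<alpha> \<and> bergman_norm p \<alpha> (f n) = 1) \<and>
     (\<forall>\<Lambda>\<in>bergman_dual p \<alpha>. (\<lambda>n. \<Lambda> (f n)) \<longlonglongrightarrow> 0)}"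


section \<open>Families of weighted composition operators\<close>

definition wcomp ::
    "(complex \<Rightarrow> complex) \<Rightarrow> (complex \<Rightarrow> complex) \<Rightarrow> (complex \<Rightarrow> complex) \<Rightarrow> complex \<Rightarrow> complex" where
  "wcomp u \<phi> f = (\<lambda>z. u z * f (\<phi> z))"

definition extends_continuously_near :: "complex \<Rightarrow> (complex \<Rightarrow> complex) \<Rightarrow> bool" where
  "extends_continuously_near \<xi> f \<longleftrightarrow>
     (\<exists>\<epsilon>>0. \<exists>g. continuous_on (cball 0 1 \<inter> ball \<xi> \<epsilon>) g \<and> (\<forall>z\<in>\<D> \<inter> ball \<xi> \<epsilon>. g z = f z))"

definition horocycle_at :: "complex \<Rightarrow> complex set \<Rightarrow> bool" where
  "horocycle_at \<xi> H \<longleftrightarrow> (\<exists>r. 0 < r \<and> r < 1 \<and> H = sphere (of_real (1 - r) * \<xi>) r)"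

text \<open>The third conjunct says that the continuous extension of \<open>\<phi> t\<close> to \<open>\<xi>\<close>, which exists
  because the derivative extends continuously, takes the value \<open>\<xi>\<close> there.\<close>

definition has_direction ::
    "complex \<Rightarrow> (real \<Rightarrow> complex \<Rightarrow> complex) \<Rightarrow> (real \<Rightarrow> complex \<Rightarrow> complex) \<Rightarrow> bool" where
  "has_direction \<xi> u \<phi> \<longleftrightarrow> (\<forall>t\<in>{0<..<1}.
     \<phi> t holomorphic_on \<D> \<and>
     extends_continuously_near \<xi> (deriv (\<phi> t)) \<and>
     (\<phi> t \<longlongrightarrow> \<xi>) (at \<xi> within \<D>) \<and>
     (\<forall>\<epsilon>>0. closure (\<phi> t ` (\<D> - ball \<xi> \<epsilon>)) \<inter> sphere 0 1 = {}) \<and>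
     (\<forall>\<epsilon>>0. \<exists>H. horocycle_at \<xi> H \<and> H \<subseteq> closure (\<phi> t ` (ball \<xi> \<epsilon> \<inter> \<D>))) \<and>
     extends_continuously_near \<xi> (u t))"

definition admissible_family ::
    "real \<Rightarrow> real \<Rightarrow> complex \<Rightarrow>
     (real \<Rightarrow> complex \<Rightarrow> complex) \<Rightarrow> (real \<Rightarrow> complex \<Rightarrow> complex) \<Rightarrow> bool" where
  "admissible_family p \<alpha> \<xi> u \<phi> \<longleftrightarrow>
     (\<forall>t\<in>{0<..<1}. \<phi> t holomorphic_on \<D> \<and> \<phi> t ` \<D> \<subseteq> \<D> \<and> u t \<in> bergman p \<alpha> \<and>
                    wcomp (u t) (\<phi> t) \<in> bergman_ops p \<alpha>) \<and>
     has_direction \<xi> u \<phi> \<and>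
     (\<integral>\<^sup>+t\<in>{0<..<1}. ennreal (bergman_opnorm p \<alpha> (wcomp (u t) (\<phi> t))) \<partial>lborel) < \<infinity> \<and>
     (\<forall>t0\<in>{0<..<1}.
        ((\<lambda>t. SUP z\<in>\<D>. cmod (\<phi> t z - \<phi> t0 z)) \<longlongrightarrow> 0) (at t0 within {0<..<1}) \<and>
        (\<forall>\<epsilon>>0. ((\<lambda>t. LINT z:\<D> - ball \<xi> \<epsilon>|dA \<alpha>. cmod (u t z - u t0 z) powr p) \<longlongrightarrow> 0)
                  (at t0 within {0<..<1})) \<and>
        (\<exists>\<epsilon>>0. \<exists>M. \<forall>t\<in>{0<..<1}. \<bar>t - t0\<bar> < \<epsilon> \<longrightarrow>
                  (\<forall>z\<in>ball \<xi> \<epsilon> \<inter> \<D>. cmod (u t z) \<le> M)) \<and>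
        (\<exists>\<epsilon>>0. \<exists>m>0. \<forall>t\<in>{0<..<1}. \<bar>t - t0\<bar> < \<epsilon> \<longrightarrow>
                  (\<forall>z\<in>ball \<xi> \<epsilon> \<inter> \<D>. m \<le> cmod (deriv (\<phi> t) z))))"


section \<open>Test functions\<close>

text \<open>The principal branch of the logarithm applied to \<open>\<xi> - z\<close> need not be continuous on the
  disk; since \<open>1 - z / \<xi>\<close> has positive real part there, the following is a holomorphic branch.
  Another branch changes the test functions only by a unimodular constant.\<close>

definition log_branch :: "complex \<Rightarrow> complex \<Rightarrow> complex" where
  "log_branch \<xi> z = Ln \<xi> + Ln (1 - z / \<xi>)"

lemma Re_pos_one_minus_div:
  assumes "\<xi> \<in> sphere 0 1" "z \<in> \<D>"
  shows "Re (1 - z / \<xi>) > 0"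
proof -
  have "Re (z / \<xi>) \<le> cmod (z / \<xi>)" by (rule complex_Re_le_cmod)
  also have "\<dots> < 1" using assms by (simp add: norm_divide)
  finally show ?thesis by simp
qed

lemma exp_log_branch:
  assumes "\<xi> \<in> sphere 0 1" "z \<in> \<D>"
  shows "exp (log_branch \<xi> z) = \<xi> - z"
proof -
  have "\<xi> \<noteq> 0" using assms by auto
  moreover have "1 - z / \<xi> \<noteq> 0" using Re_pos_one_minus_div[OF assms] by force
  ultimately show ?thesis by (simp add: log_branch_def exp_add field_simps)
qed

lemma holomorphic_log_branch:
  assumes "\<xi> \<in> sphere 0 1"
  shows "log_branch \<xi> holomorphic_on \<D>"
proof -
  have "1 - z / \<xi> \<notin> \<real>\<^sub>\<le>\<^sub>0" if "z \<in> \<D>" for z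
    using Re_pos_one_minus_div[OF assms that] by (auto simp: complex_nonpos_Reals_iff)
  moreover have "\<xi> \<noteq> 0" using assms by auto
  ultimately show ?thesis unfolding log_branch_def by (intro holomorphic_intros) auto
qed

definition test_fun_hat :: "real \<Rightarrow> complex \<Rightarrow> complex \<Rightarrow> complex" where
  "test_fun_hat c \<xi> z = exp (- of_real c * log_branch \<xi> z)"

definition test_fun :: "real \<Rightarrow> real \<Rightarrow> real \<Rightarrow> complex \<Rightarrow> complex \<Rightarrow> complex" where
  "test_fun p \<alpha> c \<xi> z = test_fun_hat c \<xi> z / of_real (bergman_norm p \<alpha> (test_fun_hat c \<xi>))"

end

(*
  Write d = phi'(xi), which is positive, and u0 = u(xi). Both sides are compared with
  L = |u0| d^(-(2 + alpha)/p).

  The mass of the test functions escapes to xi as c increases to (2 + alpha)/p, because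
  the integral of |xi - z|^(-cp) diverges there; since phi(z) - xi is asymptotic to
  d (z - xi), the norms of their images converge to L.

  A weakly null sequence tends to zero on every compact subset of the disk, so only its
  image near xi counts. There phi is injective, and the change of variables w = phi(z)
  produces the density |u|^p ((1 - |z|^2) / (1 - |phi(z)|^2))^alpha |phi'(z)|^(-2), whose
  upper limit at xi is at most L^p: the weight ratio is asymptotically at most 1/d,
  because phi maps the disk into itself.
*)

theory Submission
  imports Defs
begin

subsection \<open>Area and holomorphic maps\<close>

text \<open>The exponent (2 + \<alpha>)/p has two sources that agree only at the critical value of
  c. For weakly null sequences the Jacobian gives d^(-2) and the weight gives d^(-\<alpha>); for
  test functions it is the homogeneity of |\<xi> - z|^(-cp) as cp tends to 2 + \<alpha>. The
  delicate point is the weight ratio: z may approach \<xi> tangentially, and there the expansion of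
  \<phi> at \<xi> alone does not control 1 - |\<phi>(z)|. The bound needs \<phi>' to be close to d
  in a full neighbourhood of \<xi> in the disk. Every estimate is proved with an arbitrarily small
  loss (K above L^p, or an error \<eta>). The radius \<delta> that belongs to this loss is fixed
  before f, respectively before the exponent e, so that limits can be taken with \<delta> held
  fixed. What happens outside the ball then either tends to 0 or is a constant against a divergent
  integral.\<close>

definition complex_of_vec :: "real ^ 2 \<Rightarrow> complex" where
  "complex_of_vec v = Complex (v $ 1) (v $ 2)"

definition vec_of_complex :: "complex \<Rightarrow> real ^ 2" where
  "vec_of_complex z = vector [Re z, Im z]"

lemma vec_of_complex_nth [simp]:
  "vec_of_complex z $ 1 = Re z" "vec_of_complex z $ 2 = Im z"
  by (simp_all add: vec_of_complex_def)

lemma complex_of_vec_of_complex [simp]: "complex_of_vec (vec_of_complex z) = z"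
  by (simp add: complex_of_vec_def)

lemma vec_of_complex_of_vec [simp]: "vec_of_complex (complex_of_vec v) = v"
  by (simp add: complex_of_vec_def vec_eq_iff forall_2)

lemma bounded_linear_complex_of_vec: "bounded_linear complex_of_vec"
  unfolding linear_conv_bounded_linear[symmetric]
  by (intro linearI) (simp_all add: complex_of_vec_def complex_eq_iff)

lemma bounded_linear_vec_of_complex: "bounded_linear vec_of_complex"
  unfolding linear_conv_bounded_linear[symmetric]
  by (intro linearI) (simp_all add: vec_eq_iff forall_2)

lemma measurable_complex_of_vec [measurable]: "complex_of_vec \<in> borel_measurable borel"
  by (intro borel_measurable_continuous_onI linear_continuous_on bounded_linear_complex_of_vec)

text \<open>Lebesgue measure is determined by boxes, and these correspond under the identification
  of the plane with \<open>real ^ 2\<close>. It carries the change of variables for differentiable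
  maps of \<open>real ^ 2\<close> over to complex functions.\<close>

lemma lborel_complex_of_vec: "lborel = distr lborel borel complex_of_vec"
proof (rule lborel_eqI)
  fix l u :: complex assume le: "\<And>b. b \<in> Basis \<Longrightarrow> l \<bullet> b \<le> u \<bullet> b"
  have "complex_of_vec -` box l u = box (vec_of_complex l) (vec_of_complex u)"
    by (auto simp: complex_of_vec_def mem_box_cart forall_2 in_box_complex_iff)
  moreover have "emeasure lborel (box (vec_of_complex l) (vec_of_complex u)) =
    (\<Prod>b\<in>Basis. (u - l) \<bullet> b)"
    using le[of 1] le[of \<i>] by (subst emeasure_lborel_box)
      (auto simp: mult.commute Basis_complex_def Basis_vec_def inner_axis UNIV_2 axis_eq_axis)
  ultimately show "emeasure (distr lborel borel complex_of_vec) (box l u) = (\<Prod>b\<in>Basis. (u - l) \<bullet> b)"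
    by (simp add: emeasure_distr)
qed simp

lemma emeasure_lborel_complex_of_vec:
  "A \<in> sets borel \<Longrightarrow> emeasure lborel (complex_of_vec -` A) = emeasure lborel A"
  by (simp add: arg_cong[OF lborel_complex_of_vec, of "\<lambda>M. emeasure M A"] emeasure_distr)

text \<open>By the Cauchy-Riemann equations the real Jacobian of \<phi> is |\<phi>'|^2, so the area
  formula for injective maps yields the factor m^2. The image of F enters only as a Lebesgue set;
  the Borel set E around it makes the claim one about \<open>lborel\<close>.\<close>

lemma emeasure_holomorphic_image_ge:
  assumes holo: "\<phi> holomorphic_on U" and U: "open U" "F \<subseteq> U" and inj: "inj_on \<phi> F"
    and F: "F \<in> sets borel" and E: "E \<in> sets borel" "\<phi> ` F \<subseteq> E"
    and m: "m \<ge> 0" "\<And>z. z \<in> F \<Longrightarrow> m \<le> cmod (deriv \<phi> z)"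
  shows "ennreal (m\<^sup>2) * emeasure lborel F \<le> emeasure lborel E"
proof (cases "emeasure lborel E = \<infinity>")
  case False
  define F' where "F' = complex_of_vec -` F"
  define E' where "E' = complex_of_vec -` E"
  define f where "f v = vec_of_complex (\<phi> (complex_of_vec v))" for v
  define f' where "f' v h = vec_of_complex (deriv \<phi> (complex_of_vec v) * complex_of_vec h)" for v h
  have sets': "F' \<in> sets borel" "E' \<in> sets borel"
    using F E measurable_sets[OF measurable_complex_of_vec] by (auto simp: F'_def E'_def)
  have der: "(f has_derivative f' v) (at v within F')" if "v \<in> F'" for v
  proof -
    have "(\<phi> has_field_derivative deriv \<phi> (complex_of_vec v)) (at (complex_of_vec v))"
      using that U holo by (auto simp: F'_def intro!: holomorphic_derivI)
    then have *: "(\<phi> has_derivative (*) (deriv \<phi> (complex_of_vec v))) (at (complex_of_vec v))"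
      by (simp add: has_field_derivative_def)
    have "((\<lambda>v. \<phi> (complex_of_vec v)) has_derivative (\<lambda>h. deriv \<phi> (complex_of_vec v) * complex_of_vec h))
       (at v within F')"
      using has_derivative_compose[OF
        bounded_linear_imp_has_derivative[OF bounded_linear_complex_of_vec] *] by simp
    then show ?thesis unfolding f_def f'_def
      by (rule bounded_linear.has_derivative[OF bounded_linear_vec_of_complex])
  qed
  have inj': "inj_on f F'"
    unfolding f_def F'_def
    by (rule inj_onI) (metis complex_of_vec_of_complex inj inj_on_def vec_of_complex_of_vec vimageE)
  \<comment> \<open>Multiplication by a + ib has the real matrix with rows (a, -b) and (b, a), of
    determinant a^2 + b^2.\<close>
  have det: "det (matrix (f' v)) = (cmod (deriv \<phi> (complex_of_vec v)))\<^sup>2" for v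
    unfolding det_2 matrix_def f'_def
    by (simp add: complex_of_vec_def axis_def cmod_power2 flip: power2_eq_square)
  have fE: "f ` F' \<subseteq> E'"
    using E by (auto simp: f_def F'_def E'_def)
  have Efin: "emeasure lborel E' < \<infinity>"
    using False E by (simp add: E'_def emeasure_lborel_complex_of_vec top.not_eq_extremum)
  have El: "E' \<in> lmeasurable"
    using sets' Efin by (intro fmeasurableI) (auto simp: )
  have "f ` F' \<in> sets lebesgue"
    using sets' by (intro differentiable_image_in_sets_lebesgue)
      (auto simp: differentiable_on_def differentiable_def intro: der)
  then have fl: "f ` F' \<in> lmeasurable"
    using fmeasurableI2[OF El fE] by blast
  then have int: "(\<lambda>v. \<bar>det (matrix (f' v))\<bar>) integrable_on F'"
    using measurable_differentiable_image_eq[of F' f f'] sets' der inj' by auto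
  have meq: "measure lebesgue (f ` F') = integral F' (\<lambda>v. \<bar>det (matrix (f' v))\<bar>)"
    using sets' der inj' int by (intro measure_differentiable_image_eq) auto
  show ?thesis
  proof (cases "m = 0")
    case False
    then have mpos: "m > 0" using m by simp
    have bnd: "m\<^sup>2 \<le> \<bar>det (matrix (f' v))\<bar>" if "v \<in> F'" for v
      using m that unfolding det F'_def by (auto intro!: power_mono)
    \<comment> \<open>Finiteness of the measure of \<open>F'\<close> is not assumed. The Jacobian is
      integrable because the image lies in a set of finite measure, and it dominates the positive
      constant m^2.\<close>
    have "(\<lambda>v. m\<^sup>2) integrable_on F'"
    proof (rule measurable_bounded_by_integrable_imp_integrable[OF _ int])
      show "(\<lambda>v. m\<^sup>2) \<in> borel_measurable (lebesgue_on F')" by (rule borel_measurable_const)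
      show "F' \<in> sets lebesgue" using sets' by simp
      show "norm (m\<^sup>2) \<le> \<bar>det (matrix (f' v))\<bar>" if "v \<in> F'" for v
        using bnd[OF that] by simp
    qed
    then have Fl: "F' \<in> lmeasurable"
      using mpos integrable_on_cmult_iff[of "m\<^sup>2" "\<lambda>_. 1" F']
      by (simp add: lmeasurable_iff_integrable_on)
    have "m\<^sup>2 * measure lebesgue F' = integral F' (\<lambda>v. m\<^sup>2)"
      using Fl by (simp add: lmeasure_integral flip: integral_mult_right)
    also have "\<dots> \<le> measure lebesgue (f ` F')"
      unfolding meq by (intro integral_le int bnd) fact
    also have "\<dots> \<le> measure lebesgue E'"
      using fE fl El by (intro measure_mono_fmeasurable) (auto dest: fmeasurableD)
    finally have le: "m\<^sup>2 * measure lebesgue F' \<le> measure lebesgue E'" .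
    have "emeasure lborel F' = ennreal (measure lebesgue F')"
      using fmeasurableD2[OF Fl] sets'(1) by (simp add: emeasure_eq_ennreal_measure)
    moreover have "emeasure lborel E' = ennreal (measure lebesgue E')"
      using fmeasurableD2[OF El] sets'(2) by (simp add: emeasure_eq_ennreal_measure)
    ultimately have "ennreal (m\<^sup>2) * emeasure lborel F' \<le> emeasure lborel E'"
      using le by (simp flip: ennreal_mult)
    then show ?thesis using F E by (simp add: F'_def E'_def emeasure_lborel_complex_of_vec)
  qed simp
qed simp


text \<open>The previous estimate, read on preimages, says that m^2 times the push-forward of
  Lebesgue measure on U is at most Lebesgue measure. Integrals are monotone in the measure, so no
  approximation of h is required.\<close>

lemma nn_integral_holomorphic_le:
  assumes holo: "\<phi> holomorphic_on U" and U: "open U" and inj: "inj_on \<phi> U"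
    and m: "m \<ge> 0" "\<And>z. z \<in> U \<Longrightarrow> m \<le> cmod (deriv \<phi> z)"
    and h[measurable]: "h \<in> borel_measurable borel"
  shows "ennreal (m\<^sup>2) * (\<integral>\<^sup>+z\<in>U. h (\<phi> z) \<partial>lborel) \<le> (\<integral>\<^sup>+w. h w \<partial>lborel)"
proof -
  define M where "M = distr (restrict_space lborel U) borel \<phi>"
  have \<phi>_meas: "\<phi> \<in> borel_measurable (restrict_space lborel U)"
    using borel_measurable_continuous_on_restrict[OF holomorphic_on_imp_continuous_on[OF holo]]
    by (simp cong: measurable_cong_sets sets_restrict_space_cong)
  have U_sets [measurable]: "U \<in> sets lborel" using U by simp
  have M_eq: "emeasure M A = emeasure lborel (\<phi> -` A \<inter> U)" if "A \<in> sets borel" for A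
    using that \<phi>_meas by (simp add: M_def emeasure_distr emeasure_restrict_space space_restrict_space U)
  have "ennreal (m\<^sup>2) * (\<integral>\<^sup>+z\<in>U. h (\<phi> z) \<partial>lborel) = ennreal (m\<^sup>2) * (\<integral>\<^sup>+w. h w \<partial>M)"
    unfolding M_def using \<phi>_meas by (simp add: nn_integral_distr nn_integral_restrict_space U)
  also have "\<dots> = (\<integral>\<^sup>+w. h w \<partial>scale_measure (ennreal (m\<^sup>2)) M)"
    by (rule nn_integral_scale_measure[symmetric]) (simp add: M_def)
  also have "\<dots> \<le> (\<integral>\<^sup>+w. h w \<partial>lborel)"
  proof (rule nn_integral_mono_measure)
    show "scale_measure (ennreal (m\<^sup>2)) M \<le> lborel"
    proof (subst le_measure, simp add: M_def, safe)
      fix A assume "A \<in> sets (scale_measure (ennreal (m\<^sup>2)) M)"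
      then have A: "A \<in> sets borel" by (simp add: M_def)
      have "\<phi> -` A \<inter> U \<in> sets borel"
        using measurable_sets[OF \<phi>_meas A] U
        by (simp add: space_restrict_space sets_restrict_space_iff)
      then have "ennreal (m\<^sup>2) * emeasure lborel (\<phi> -` A \<inter> U) \<le> emeasure lborel A"
        using A m by (intro emeasure_holomorphic_image_ge[OF holo U _ inj_on_subset[OF inj]]) auto
      then show "emeasure (scale_measure (ennreal (m\<^sup>2)) M) A \<le> emeasure lborel A"
        using M_eq[OF A] by simp
    qed
  qed (simp add: M_def)
  finally show ?thesis .
qed

text \<open>The area estimate with m = 1 gives one inequality for \<omega> and, applied to the
  inverse rotation by \<open>cnj \<omega>\<close>, the other.\<close>

lemma lborel_distr_rotation:
  fixes \<omega> :: complex
  assumes "cmod \<omega> = 1"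
  shows "distr lborel borel ((*) \<omega>) = lborel"
proof (rule measure_eqI)
  fix A assume "A \<in> sets (distr lborel borel ((*) \<omega>))"
  then have A: "A \<in> sets borel" by simp
  have le: "emeasure lborel ((*) a -` B) \<le> emeasure lborel B"
    if a: "cmod a = 1" and B: "B \<in> sets borel" for a B
  proof -
    have "(*) a -` B \<in> sets borel"
      using measurable_sets[of "(*) a" borel borel B] B by simp
    moreover have "inj_on ((*) a) ((*) a -` B)" using a by (auto simp: inj_on_def)
    moreover have "deriv ((*) a) z = a" for z
      by (auto intro!: DERIV_imp_deriv derivative_eq_intros)
    ultimately show ?thesis
      using emeasure_holomorphic_image_ge[of "(*) a" UNIV "(*) a -` B" B 1] a B
      by (auto intro!: holomorphic_intros)
  qed
  have inv: "cnj \<omega> * \<omega> = 1" using assms by (simp add: complex_norm_square[symmetric] mult.commute)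
  have "(*) (cnj \<omega>) -` ((*) \<omega> -` A) = A"
    by (auto simp: inv mult.assoc[symmetric] mult.commute[of \<omega>])
  moreover have "(*) \<omega> -` A \<in> sets borel"
    using measurable_sets[of "(*) \<omega>" borel borel A] A by simp
  ultimately have "emeasure lborel ((*) \<omega> -` A) = emeasure lborel A"
    using le[OF assms A] le[of "cnj \<omega>" "(*) \<omega> -` A"] assms by (auto intro: antisym)
  then show "emeasure (distr lborel borel ((*) \<omega>)) A = emeasure lborel A"
    using A by (simp add: emeasure_distr)
qed simp

subsection \<open>The area mean value property\<close>

text \<open>Substituting \<open>\<omega> z\<close> for \<open>z\<close> with \<open>\<omega> ^ n = -1\<close> changes the sign of the integral.\<close>

lemma integral_cball_power_eq_0:
  assumes "n > 0"
  shows "(LINT z|lborel. indicator (cball 0 r) z *\<^sub>R (z::complex) ^ n) = 0"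
proof -
  define \<omega> where "\<omega> = cis (pi / real n)"
  define I where "I = (LINT z|lborel. indicator (cball 0 r) z *\<^sub>R (z::complex) ^ n)"
  have \<omega>: "cmod \<omega> = 1" "\<omega> ^ n = -1"
    using assms Complex.DeMoivre[of "pi / real n" n] by (simp_all add: \<omega>_def)
  have "I = (LINT z|distr lborel borel ((*) \<omega>). indicator (cball 0 r) z *\<^sub>R z ^ n)"
    by (simp add: I_def lborel_distr_rotation \<omega>)
  also have "\<dots> = (LINT z|lborel. indicator (cball 0 r) (\<omega> * z) *\<^sub>R (\<omega> * z) ^ n)"
    by (rule integral_distr) (auto intro!: borel_measurable_continuous_on_indicator continuous_intros)
  also have "\<dots> = (LINT z|lborel. - (indicator (cball 0 r) z *\<^sub>R z ^ n))"
    using \<omega> by (intro Bochner_Integration.integral_cong)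
      (auto simp: indicator_def norm_mult power_mult_distrib)
  also have "\<dots> = - I" by (simp add: I_def)
  finally show ?thesis by (simp add: I_def)
qed

text \<open>Expand f in its power series at w and integrate term by term: all powers of positive
  degree integrate to 0 by rotation, and the constant term contributes f(w) times the area.\<close>

lemma integral_cball_holomorphic:
  assumes holo: "f holomorphic_on ball w R" and r: "0 < r" "r < R"
  shows "(LINT z|lborel. indicator (cball w r) z *\<^sub>R f z) = of_real (pi * r\<^sup>2) * f w"
proof -
  define a where "a n = (deriv ^^ n) f w / fact n" for n
  have sums: "(\<lambda>n. a n * z ^ n) sums f (w + z)" if "norm z < R" for z
    using holomorphic_power_series[OF holo, of "w + z"] that by (simp add: a_def dist_norm)
  \<comment> \<open>Convergence at the intermediate radius (r + R)/2 gives absolute convergence at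
    r, hence a summable majorant on the whole closed disk of radius r.\<close>
  have "(\<lambda>n. a n * of_real ((r + R) / 2) ^ n) sums f (w + of_real ((r + R) / 2))"
    using r by (intro sums) (simp del: of_real_add of_real_divide)
  then have "summable (\<lambda>n. norm (a n * of_real r ^ n))"
    using r by (intro powser_insidea[of _ "of_real ((r + R) / 2)"])
      (auto simp: sums_iff simp del: of_real_add of_real_divide)
  then have summ: "summable (\<lambda>n. cmod (a n) * r ^ n)"
    using r by (simp add: norm_mult norm_power)
  let ?f = "\<lambda>n z. indicator (cball 0 r) z *\<^sub>R (a n * z ^ n)"
  have int: "integrable lborel (?f n)" for n
    by (intro borel_integrable_compact continuous_intros) auto
  have vol: "emeasure lborel (cball (0::complex) r) = ennreal (pi * r\<^sup>2)"
    using r emeasure_cball[of r "0::complex"] by (simp add: eval_unit_ball_vol)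
  have cint: "integrable lborel (\<lambda>z. indicator (cball (0::complex) r) z *\<^sub>R (c::real))" for c
    by (intro borel_integrable_compact) auto
  have "(\<lambda>n. integral\<^sup>L lborel (?f n)) sums (LINT z|lborel. (\<Sum>n. ?f n z))"
  proof (rule sums_integral[OF int])
    show "AE z in lborel. summable (\<lambda>n. norm (?f n z))"
    proof (rule AE_I2)
      fix z :: complex
      show "summable (\<lambda>n. norm (?f n z))"
      proof (cases "z \<in> cball 0 r")
        case True
        show ?thesis
          by (rule summable_comparison_test'[OF summ, of 0])
            (use True in \<open>auto simp: norm_mult norm_power intro!: mult_left_mono power_mono\<close>)
      qed simp
    qed
    show "summable (\<lambda>n. LINT z|lborel. norm (?f n z))"
    proof (rule summable_comparison_test'[of "\<lambda>n. cmod (a n) * r ^ n * (pi * r\<^sup>2)" 0])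
      show "summable (\<lambda>n. cmod (a n) * r ^ n * (pi * r\<^sup>2))"
        using summ by (rule summable_mult2)
      fix n
      have "(LINT z|lborel. norm (?f n z)) \<le>
          (LINT z|lborel. indicator (cball (0::complex) r) z *\<^sub>R (cmod (a n) * r ^ n))"
        by (intro integral_mono[OF integrable_norm[OF int] cint])
          (auto simp: indicator_def norm_mult norm_power intro!: mult_left_mono power_mono)
      also have "\<dots> = cmod (a n) * r ^ n * (pi * r\<^sup>2)"
        using r vol by (simp add: measure_def)
      finally show "norm (LINT z|lborel. norm (?f n z)) \<le> cmod (a n) * r ^ n * (pi * r\<^sup>2)"
        by simp
    qed
  qed
  moreover have "(\<Sum>n. ?f n z) = indicator (cball 0 r) z *\<^sub>R f (w + z)" for z
    using sums[of z] r by (cases "z \<in> cball 0 r") (auto simp: sums_iff)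
  moreover have "integral\<^sup>L lborel (?f n) = (if n = 0 then of_real (pi * r\<^sup>2) * f w else 0)" for n
  proof (cases "n = 0")
    case True
    have "integral\<^sup>L lborel (?f n) = measure lborel (cball (0::complex) r) *\<^sub>R f w"
      using True cint[of 1] by (simp add: a_def integral_scaleR_left)
    then show ?thesis using True vol r by (simp add: measure_def scaleR_conv_of_real)
  next
    case False
    have "integral\<^sup>L lborel (?f n) = a n * (LINT z|lborel. indicator (cball 0 r) z *\<^sub>R z ^ n)"
      by (simp flip: integral_mult_right_zero)
    with False show ?thesis by (simp add: integral_cball_power_eq_0)
  qed
  ultimately have "(\<lambda>n. if n = 0 then of_real (pi * r\<^sup>2) * f w else 0) sums
      (LINT z|lborel. indicator (cball 0 r) z *\<^sub>R f (w + z))"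
    by simp
  moreover have "(\<lambda>n::nat. if n = 0 then of_real (pi * r\<^sup>2) * f w else 0) sums (of_real (pi * r\<^sup>2) * f w)"
    using sums_single[of 0 "\<lambda>_. of_real (pi * r\<^sup>2) * f w"] by simp
  ultimately have eq: "(LINT z|lborel. indicator (cball 0 r) z *\<^sub>R f (w + z)) = of_real (pi * r\<^sup>2) * f w"
    by (rule sums_unique2)
  have cont: "continuous_on (cball w r) f"
    using holo r by (intro holomorphic_on_imp_continuous_on holomorphic_on_subset[OF holo]) auto
  have "(LINT z|lborel. indicator (cball w r) z *\<^sub>R f z) =
      (LINT z|distr lborel borel ((+) w). indicator (cball w r) z *\<^sub>R f z)"
    by (simp add: lborel_distr_plus)
  also have "\<dots> = (LINT z|lborel. indicator (cball w r) (w + z) *\<^sub>R f (w + z))"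
    using cont by (intro integral_distr borel_measurable_continuous_on_indicator) auto
  also have "\<dots> = (LINT z|lborel. indicator (cball 0 r) z *\<^sub>R f (w + z))"
    by (intro Bochner_Integration.integral_cong) (auto simp: indicator_def dist_norm)
  finally show ?thesis using eq by simp
qed

text \<open>The mean value property and the triangle inequality for integrals. The exponent p is
  brought in later, by an elementary inequality instead of Jensen's.\<close>

lemma norm_holomorphic_le_integral:
  assumes holo: "f holomorphic_on ball w R" and r: "0 < r" "r < R"
  shows "ennreal (pi * r\<^sup>2) * ennreal (cmod (f w)) \<le> (\<integral>\<^sup>+z\<in>cball w r. ennreal (cmod (f z)) \<partial>lborel)"
proof -
  have cont: "continuous_on (cball w r) f"
    using holo r by (intro holomorphic_on_imp_continuous_on holomorphic_on_subset[OF holo]) auto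
  have int: "integrable lborel (\<lambda>z. indicator (cball w r) z *\<^sub>R f z)"
    using cont by (intro borel_integrable_compact) auto
  have "ennreal (pi * r\<^sup>2) * ennreal (cmod (f w)) =
      ennreal (cmod (LINT z|lborel. indicator (cball w r) z *\<^sub>R f z))"
    by (simp add: integral_cball_holomorphic[OF assms] norm_mult flip: ennreal_mult)
      (simp add: norm_power)
  also have "\<dots> \<le> ennreal (LINT z|lborel. norm (indicator (cball w r) z *\<^sub>R f z))"
    by (intro ennreal_leI integral_norm_bound)
  also have "\<dots> = (\<integral>\<^sup>+z. ennreal (norm (indicator (cball w r) z *\<^sub>R f z)) \<partial>lborel)"
    by (intro nn_integral_eq_integral[OF integrable_norm[OF int], symmetric]) auto
  also have "\<dots> = (\<integral>\<^sup>+z\<in>cball w r. ennreal (cmod (f z)) \<partial>lborel)"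
    by (intro nn_integral_cong) (auto simp: indicator_def)
  finally show ?thesis .
qed

subsection \<open>Bergman spaces\<close>

definition bergman_weight :: "real \<Rightarrow> complex \<Rightarrow> real" where
  "bergman_weight \<alpha> z = (1 + \<alpha>) * (1 - (cmod z)\<^sup>2) powr \<alpha> / pi"

lemma bergman_weight_nonneg: "\<alpha> \<ge> 0 \<Longrightarrow> bergman_weight \<alpha> z \<ge> 0"
  by (simp add: bergman_weight_def)

lemma measurable_bergman_weight [measurable]: "bergman_weight \<alpha> \<in> borel_measurable borel"
  unfolding bergman_weight_def by measurable

lemma space_dA [simp]: "space (dA \<alpha>) = \<D>"
  by (simp add: dA_def space_restrict_space)

lemma sets_dA [measurable_cong]: "sets (dA \<alpha>) = sets (restrict_space borel \<D>)"
  by (simp add: dA_def cong: sets_restrict_space_cong)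

lemma continuous_on_measurable_dA:
  "continuous_on \<D> f \<Longrightarrow> f \<in> borel_measurable (dA \<alpha>)"
  using borel_measurable_continuous_on_restrict[of \<D> f]
  by (simp cong: measurable_cong_sets add: sets_dA)

lemma holomorphic_measurable_dA:
  "f holomorphic_on \<D> \<Longrightarrow> f \<in> borel_measurable (dA \<alpha>)"
  by (intro continuous_on_measurable_dA holomorphic_on_imp_continuous_on)

lemma nn_integral_dA:
  fixes g :: "complex \<Rightarrow> ennreal"
  assumes "g \<in> borel_measurable (dA \<alpha>)"
  shows "(\<integral>\<^sup>+z. g z \<partial>dA \<alpha>) = (\<integral>\<^sup>+z\<in>\<D>. ennreal (bergman_weight \<alpha> z) * g z \<partial>lborel)"
proof -
  have g: "g \<in> borel_measurable (restrict_space lborel \<D>)"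
    using assms by (simp add: sets_dA cong: measurable_cong_sets sets_restrict_space_cong)
  show ?thesis
    unfolding dA_def bergman_weight_def[symmetric] using g
    by (subst nn_integral_density) (auto simp: nn_integral_restrict_space intro!: measurable_restrict_space1)
qed

lemma bergmanD:
  assumes "f \<in> bergman p \<alpha>"
  shows "f holomorphic_on \<D>" "integrable (dA \<alpha>) (\<lambda>z. cmod (f z) powr p)"
  using assms by (auto simp: bergman_def)

lemma bergman_norm_nonneg: "bergman_norm p \<alpha> f \<ge> 0"
  by (simp add: bergman_norm_def)

lemma bergman_norm_powr:
  "p > 0 \<Longrightarrow> bergman_norm p \<alpha> f powr p = (LINT z|dA \<alpha>. cmod (f z) powr p)"
  by (simp add: bergman_norm_def powr_powr)

lemma nn_integral_bergman:
  assumes "f \<in> bergman p \<alpha>" "p > 0"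
  shows "(\<integral>\<^sup>+z. ennreal (cmod (f z) powr p) \<partial>dA \<alpha>) = ennreal (bergman_norm p \<alpha> f powr p)"
  using assms by (subst nn_integral_eq_integral) (auto simp: bergmanD bergman_norm_powr)

lemma bergman_norm_cmult:
  assumes "p > 0"
  shows "bergman_norm p \<alpha> (\<lambda>z. a * f z) = cmod a * bergman_norm p \<alpha> f"
  using assms by (simp add: bergman_norm_def norm_mult powr_mult powr_powr)

lemma bergman_cmult:
  "f \<in> bergman p \<alpha> \<Longrightarrow> (\<lambda>z. a * f z) \<in> bergman p \<alpha>"
  by (auto simp: bergman_def norm_mult powr_mult intro!: holomorphic_intros)

text \<open>On a disk of fixed size around w the weight is bounded below, so the area mean of |f| is
  controlled by the integral of |f|^p against the weight. This gives a constant on the unit ball of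
  the space, and homogeneity gives the general bound.\<close>

lemma bergman_point_bound:
  assumes p: "p > 1" and \<alpha>: "\<alpha> \<ge> 0" and \<rho>: "0 \<le> \<rho>" "\<rho> < 1"
  obtains C where "C > 0"
    "\<And>f w. f \<in> bergman p \<alpha> \<Longrightarrow> cmod w \<le> \<rho> \<Longrightarrow> cmod (f w) \<le> C * bergman_norm p \<alpha> f"
proof -
  \<comment> \<open>With \<rho> = 1 - 2r, the disk of radius 2r about w stays inside the unit disk
    and the closed disk of radius r stays inside |z| \<le> 1 - r. The two summands in the numerator
    of \<open>C\<close> bound the integrals of 1 and of |f|^p over the latter disk.\<close>
  define r where "r = (1 - \<rho>) / 2"
  define m where "m = r powr \<alpha> / pi"
  define C where "C = (pi * r\<^sup>2 + 1 / m) / (pi * r\<^sup>2)"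
  have r: "0 < r" "\<rho> + r = 1 - r" using \<rho> by (simp_all add: r_def field_simps)
  have m: "m > 0" using r by (simp add: m_def)
  have unit: "cmod (f w) \<le> C"
    if f: "f \<in> bergman p \<alpha>" "bergman_norm p \<alpha> f \<le> 1" and w: "cmod w \<le> \<rho>" for f w
  proof -
    have sub: "cmod z \<le> 1 - r" if "z \<in> cball w r" for z
      using norm_triangle_sub[of z w] that w r by (auto simp: dist_norm norm_minus_commute)
    have wt: "m \<le> bergman_weight \<alpha> z" if "z \<in> cball w r" for z
    proof -
      have "(cmod z)\<^sup>2 \<le> cmod z"
        using sub[OF that] r by (simp add: power2_eq_square mult_left_le)
      then have "r powr \<alpha> \<le> (1 - (cmod z)\<^sup>2) powr \<alpha>"
        using sub[OF that] r \<alpha> by (intro powr_mono2) auto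
      also have "\<dots> \<le> (1 + \<alpha>) * (1 - (cmod z)\<^sup>2) powr \<alpha>"
        using \<alpha> by (simp add: algebra_simps)
      finally show ?thesis by (simp add: m_def bergman_weight_def divide_right_mono)
    qed
    have "ball w (2 * r) \<subseteq> \<D>"
    proof
      fix z assume "z \<in> ball w (2 * r)"
      then show "z \<in> \<D>"
        using norm_triangle_sub[of z w] w r by (auto simp: dist_norm norm_minus_commute)
    qed
    then have holo: "f holomorphic_on ball w (2 * r)"
      using bergmanD(1)[OF f(1)] by (rule holomorphic_on_subset[rotated])
    have meas: "(\<lambda>z. ennreal (cmod (f z) powr p)) \<in> borel_measurable (dA \<alpha>)"
      using holomorphic_measurable_dA[OF bergmanD(1)[OF f(1)]] by measurable
    have cont: "continuous_on (cball w r) f"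
      using holo r by (intro holomorphic_on_imp_continuous_on holomorphic_on_subset[OF holo]) auto
    have ind: "(\<lambda>z. ennreal (cmod (f z) powr p) * indicator (cball w r) z) \<in> borel_measurable lborel"
    proof -
      have [measurable]: "cball w r \<in> sets borel" by simp
      have [measurable]: "(\<lambda>z. indicator (cball w r) z *\<^sub>R f z) \<in> borel_measurable borel"
        using cont by (intro borel_measurable_continuous_on_indicator) auto
      have "(\<lambda>z. ennreal (cmod (indicator (cball w r) z *\<^sub>R f z) powr p) * indicator (cball w r) z)
          \<in> borel_measurable lborel" by measurable
      also have "(\<lambda>z. ennreal (cmod (indicator (cball w r) z *\<^sub>R f z) powr p) * indicator (cball w r) z) =
         (\<lambda>z. ennreal (cmod (f z) powr p) * indicator (cball w r) z)"
        by (auto simp: fun_eq_iff indicator_def)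
      finally show ?thesis .
    qed
    \<comment> \<open>A crude substitute for Hoelder's inequality. It is not homogeneous, which is
      harmless because f is normalised at this stage.\<close>
    have le1: "x \<le> 1 + x powr p" if "x \<ge> 0" for x :: real
    proof (cases "x \<le> 1")
      case False
      then have "x powr 1 \<le> x powr p" using p by (intro powr_mono) auto
      then show ?thesis using False by simp
    qed (simp add: add_increasing2)
    have "ennreal m * (\<integral>\<^sup>+z\<in>cball w r. ennreal (cmod (f z) powr p) \<partial>lborel)
       = (\<integral>\<^sup>+z\<in>cball w r. ennreal m * ennreal (cmod (f z) powr p) \<partial>lborel)"
      using ind by (subst nn_integral_cmult[symmetric]) (auto simp: mult_ac)
    also have "\<dots> \<le> (\<integral>\<^sup>+z\<in>\<D>. ennreal (bergman_weight \<alpha> z) * ennreal (cmod (f z) powr p) \<partial>lborel)"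
    proof (intro nn_integral_mono)
      fix z
      show "ennreal m * ennreal (cmod (f z) powr p) * indicator (cball w r) z \<le>
         ennreal (bergman_weight \<alpha> z) * ennreal (cmod (f z) powr p) * indicator \<D> z"
        using sub[of z] wt[of z] r
        by (cases "z \<in> cball w r") (auto simp: indicator_def intro!: mult_right_mono ennreal_leI)
    qed
    also have "\<dots> = ennreal (bergman_norm p \<alpha> f powr p)"
      using nn_integral_bergman[OF f(1)] p meas by (simp add: nn_integral_dA)
    also have "\<dots> \<le> 1"
      using f(2) p bergman_norm_nonneg[of p \<alpha> f] powr_mono2[of p "bergman_norm p \<alpha> f" 1]
      by (simp add: ennreal_le_1)
    finally have I: "ennreal m * (\<integral>\<^sup>+z\<in>cball w r. ennreal (cmod (f z) powr p) \<partial>lborel) \<le> 1" .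
    have I': "(\<integral>\<^sup>+z\<in>cball w r. ennreal (cmod (f z) powr p) \<partial>lborel) \<le> ennreal (1 / m)" (is "?I \<le> _")
    proof -
      have "?I = ennreal (1 / m) * (ennreal m * ?I)"
        using m by (simp add: mult.assoc[symmetric] ennreal_mult[symmetric])
      also have "\<dots> \<le> ennreal (1 / m) * 1" by (intro mult_left_mono I) simp
      finally show ?thesis by simp
    qed
    have "ennreal (pi * r\<^sup>2) * ennreal (cmod (f w)) \<le> (\<integral>\<^sup>+z\<in>cball w r. ennreal (cmod (f z)) \<partial>lborel)"
      using norm_holomorphic_le_integral[OF holo] r by simp
    also have "\<dots> \<le> (\<integral>\<^sup>+z. indicator (cball w r) z + ennreal (cmod (f z) powr p) * indicator (cball w r) z \<partial>lborel)"
    proof (intro nn_integral_mono)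
      fix z
      have "ennreal (cmod (f z)) \<le> ennreal (1 + cmod (f z) powr p)"
        by (intro ennreal_leI le1) simp
      then show "ennreal (cmod (f z)) * indicator (cball w r) z \<le>
          indicator (cball w r) z + ennreal (cmod (f z) powr p) * indicator (cball w r) z"
        by (auto simp: indicator_def)
    qed
    also have "\<dots> = ennreal (pi * r\<^sup>2) + ?I"
      using ind r emeasure_cball[of r w]
      by (subst nn_integral_add)
        (auto simp: eval_unit_ball_vol intro!: borel_measurable_indicator)
    also have "\<dots> \<le> ennreal (pi * r\<^sup>2 + 1 / m)"
      using I' m by (subst ennreal_plus) (auto intro: add_left_mono)
    finally have "pi * r\<^sup>2 * cmod (f w) \<le> pi * r\<^sup>2 + 1 / m"
      using m by (subst (asm) ennreal_mult[symmetric]) (auto simp del: ennreal_plus simp: ennreal_le_iff)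
    then show ?thesis using r by (simp add: C_def field_simps)
  qed
  have C: "C > 0" using r m by (auto simp: C_def intro!: divide_pos_pos add_pos_pos)
  have "cmod (f w) \<le> C * bergman_norm p \<alpha> f" if f: "f \<in> bergman p \<alpha>" and w: "cmod w \<le> \<rho>" for f w
  proof -
    \<comment> \<open>Scaling by a number s above the norm, and letting s decrease to it, also
      covers functions of norm 0.\<close>
    have "cmod (f w) / C \<le> s" if s: "bergman_norm p \<alpha> f < s" for s
    proof -
      have s0: "s > 0" using s bergman_norm_nonneg[of p \<alpha> f] by linarith
      have "cmod (of_real (1 / s) * f w) \<le> C"
        using s s0 p w by (intro unit[OF bergman_cmult[OF f]])
          (auto simp: bergman_norm_cmult simp del: of_real_divide)
      then show ?thesis using s0 C by (simp add: norm_mult norm_divide field_simps)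
    qed
    then have "cmod (f w) / C \<le> bergman_norm p \<alpha> f" by (rule dense_ge)
    then show ?thesis using C by (simp add: field_simps)
  qed
  with C show ?thesis by (rule that)
qed

text \<open>Evaluation at w is linear and, by the point bound, continuous, so weak convergence can
  be tested on it.\<close>

lemma weakly_null_pointwise:
  assumes p: "p > 1" and \<alpha>: "\<alpha> \<ge> 0" and f: "f \<in> weakly_null_unit_seqs p \<alpha>" and w: "w \<in> \<D>"
  shows "(\<lambda>n. f n w) \<longlonglongrightarrow> 0"
proof -
  obtain C where "C > 0"
    "\<And>f v. f \<in> bergman p \<alpha> \<Longrightarrow> cmod v \<le> cmod w \<Longrightarrow> cmod (f v) \<le> C * bergman_norm p \<alpha> f"
    using bergman_point_bound[OF p \<alpha>, of "cmod w"] w by auto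
  then have "(\<lambda>f. f w) \<in> bergman_dual p \<alpha>" by (auto simp: bergman_dual_def)
  with f show ?thesis by (auto simp: weakly_null_unit_seqs_def)
qed

subsection \<open>Boundary behaviour of the symbols\<close>

lemma sphere_islimpt_disk:
  "\<xi> \<in> sphere 0 1 \<Longrightarrow> \<xi> islimpt \<D>"
  by (simp add: islimpt_ball)

lemma extends_continuously_near_tendsto:
  assumes "\<xi> \<in> sphere 0 1" "extends_continuously_near \<xi> f"
  obtains l where "(f \<longlongrightarrow> l) (at \<xi> within \<D>)"
proof -
  obtain \<epsilon> g where \<epsilon>: "\<epsilon> > 0" and g: "continuous_on (cball 0 1 \<inter> ball \<xi> \<epsilon>) g"
    and eq: "\<And>z. z \<in> \<D> \<inter> ball \<xi> \<epsilon> \<Longrightarrow> g z = f z"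
    using assms(2) by (auto simp: extends_continuously_near_def)
  have "(g \<longlongrightarrow> g \<xi>) (at \<xi> within cball 0 1 \<inter> ball \<xi> \<epsilon>)"
    using g assms(1) \<epsilon> by (auto simp: continuous_on_def)
  then have "(g \<longlongrightarrow> g \<xi>) (at \<xi> within \<D> \<inter> ball \<xi> \<epsilon>)"
    by (rule tendsto_within_subset) auto
  then have "(f \<longlongrightarrow> g \<xi>) (at \<xi> within \<D> \<inter> ball \<xi> \<epsilon>)"
    by (rule Lim_transform_within[of _ _ _ _ 1]) (auto simp: eq)
  moreover have "at \<xi> within \<D> \<inter> ball \<xi> \<epsilon> = at \<xi> within \<D>"
    using \<epsilon> by (intro at_within_nhd[of _ "ball \<xi> \<epsilon>"]) auto
  ultimately show ?thesis using that by simp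
qed

text \<open>Since \<xi> is not in the open disk, the punctured neighbourhoods of the filter need no
  exclusion of the centre.\<close>

lemma eventually_at_within_disk:
  assumes "\<xi> \<in> sphere 0 1"
  shows "eventually P (at \<xi> within \<D>) \<longleftrightarrow> (\<exists>\<delta>>0. \<forall>z\<in>\<D> \<inter> ball \<xi> \<delta>. P z)"
proof -
  have "z \<noteq> \<xi>" if "z \<in> \<D>" for z using that assms by auto
  then show ?thesis by (auto simp: eventually_at dist_commute)
qed

text \<open>The setting for a single symbol. The limit d of the derivative is left complex; that it
  is real and nonnegative is a consequence of \<phi> mapping the disk into itself.\<close>

locale boundary_fixed =
  fixes \<xi> :: complex and \<phi> :: "complex \<Rightarrow> complex" and d :: complex
  assumes \<xi>: "\<xi> \<in> sphere 0 1"
    and holo: "\<phi> holomorphic_on \<D>"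
    and maps: "\<And>z. z \<in> \<D> \<Longrightarrow> \<phi> z \<in> \<D>"
    and lim: "(\<phi> \<longlongrightarrow> \<xi>) (at \<xi> within \<D>)"
    and lim_deriv: "(deriv \<phi> \<longlongrightarrow> d) (at \<xi> within \<D>)"
begin

lemma \<xi>_norm: "cmod \<xi> = 1" using \<xi> by simp

lemma \<xi>_ne: "\<xi> \<noteq> 0" using \<xi>_norm by auto

lemma nontrivial [simp]: "at \<xi> within \<D> \<noteq> bot"
  using sphere_islimpt_disk[OF \<xi>] by (simp add: trivial_limit_within)

text \<open>The function \<phi>(z) - dz has derivative \<phi>' - d, and the intersection of the two
  balls is convex, so the mean value inequality applies. Later uses are injectivity near \<xi>, the
  expansion at \<xi> and the radial comparison.\<close>

lemma linear_bound:
  assumes "\<And>z. z \<in> \<D> \<inter> ball \<xi> \<delta> \<Longrightarrow> cmod (deriv \<phi> z - d) \<le> \<eta>"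
    and "z \<in> \<D> \<inter> ball \<xi> \<delta>" "w \<in> \<D> \<inter> ball \<xi> \<delta>"
  shows "cmod (\<phi> z - \<phi> w - d * (z - w)) \<le> \<eta> * cmod (z - w)"
proof -
  have "cmod ((\<phi> z - d * z) - (\<phi> w - d * w)) \<le> \<eta> * cmod (z - w)"
  proof (rule field_differentiable_bound[where S="\<D> \<inter> ball \<xi> \<delta>" and f'="\<lambda>z. deriv \<phi> z - d"])
    show "((\<lambda>z. \<phi> z - d * z) has_field_derivative deriv \<phi> v - d) (at v within \<D> \<inter> ball \<xi> \<delta>)"
      if "v \<in> \<D> \<inter> ball \<xi> \<delta>" for v
      using that
      by (auto intro!: derivative_eq_intros has_field_derivative_at_within[OF holomorphic_derivI[OF holo]])
  qed (use assms in \<open>auto intro: convex_Int\<close>)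
  then show ?thesis by (simp add: algebra_simps)
qed

lemma deriv_near:
  assumes "\<eta> > 0"
  obtains \<delta> where "\<delta> > 0" "\<And>z. z \<in> \<D> \<inter> ball \<xi> \<delta> \<Longrightarrow> cmod (deriv \<phi> z - d) \<le> \<eta>"
proof -
  have "\<forall>\<^sub>F z in at \<xi> within \<D>. cmod (deriv \<phi> z - d) \<le> \<eta>"
    using tendstoD[OF lim_deriv assms] by eventually_elim (simp add: dist_norm)
  then show ?thesis using that by (auto simp: eventually_at_within_disk[OF \<xi>])
qed

lemma linear_bound_at_\<xi>:
  assumes "\<And>z. z \<in> \<D> \<inter> ball \<xi> \<delta> \<Longrightarrow> cmod (deriv \<phi> z - d) \<le> \<eta>" and "\<delta> > 0"
    and "z \<in> \<D> \<inter> ball \<xi> \<delta>"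
  shows "cmod (\<phi> z - \<xi> - d * (z - \<xi>)) \<le> \<eta> * cmod (z - \<xi>)"
proof (rule tendsto_le[of "at \<xi> within \<D>"])
  show "((\<lambda>w. cmod (\<phi> z - \<phi> w - d * (z - w))) \<longlongrightarrow> cmod (\<phi> z - \<xi> - d * (z - \<xi>))) (at \<xi> within \<D>)"
    by (intro tendsto_intros lim)
  show "((\<lambda>w. \<eta> * cmod (z - w)) \<longlongrightarrow> \<eta> * cmod (z - \<xi>)) (at \<xi> within \<D>)"
    by (intro tendsto_intros)
  show "\<forall>\<^sub>F w in at \<xi> within \<D>. cmod (\<phi> z - \<phi> w - d * (z - w)) \<le> \<eta> * cmod (z - w)"
    unfolding eventually_at_within_disk[OF \<xi>]
    using assms linear_bound[of \<delta> \<eta> z] by (intro exI[of _ \<delta>]) blast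
qed simp

text \<open>The vector -\<xi>v points into the disk. If d turned it outwards, then \<phi>(\<xi>(1 -
  sv)), which is \<xi>(1 - sdv) up to o(s), would leave the disk for small s > 0.\<close>

lemma Re_derivative_direction:
  assumes "Re v > 0"
  shows "Re (d * v) \<ge> 0"
proof (rule ccontr)
  assume neg: "\<not> Re (d * v) \<ge> 0"
  have v: "cmod v > 0" using assms by auto
  \<comment> \<open>With this \<eta> the error of the linear approximation is at most half of the
    outward gain -s Re(dv).\<close>
  define \<eta> where "\<eta> = - Re (d * v) / (2 * cmod v)"
  have \<eta>: "\<eta> > 0" "\<eta> * cmod v = - Re (d * v) / 2"
    using neg v by (auto simp: \<eta>_def divide_neg_pos)
  obtain \<delta> where \<delta>: "\<delta> > 0" "\<And>z. z \<in> \<D> \<inter> ball \<xi> \<delta> \<Longrightarrow> cmod (deriv \<phi> z - d) \<le> \<eta>"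
    using deriv_near[OF \<eta>(1)] by blast
  \<comment> \<open>The first entry keeps z within distance \<delta> of \<xi>; the second makes |1 -
    sv|^2 \<le> 1 - s Re v, so z lies in the disk.\<close>
  define s where "s = min (\<delta> / (2 * cmod v)) (Re v / (cmod v)\<^sup>2)"
  have s: "s > 0" "s * cmod v < \<delta>" "s * (cmod v)\<^sup>2 \<le> Re v"
  proof -
    show "s > 0" using \<delta> v assms by (simp add: s_def)
    have "s * cmod v \<le> \<delta> / (2 * cmod v) * cmod v"
      by (intro mult_right_mono) (auto simp: s_def)
    also have "\<dots> < \<delta>" using v \<delta> by simp
    finally show "s * cmod v < \<delta>" .
    have "s * (cmod v)\<^sup>2 \<le> Re v / (cmod v)\<^sup>2 * (cmod v)\<^sup>2"
      by (intro mult_right_mono) (auto simp: s_def)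
    then show "s * (cmod v)\<^sup>2 \<le> Re v" using v by simp
  qed
  define z where "z = \<xi> * (1 - of_real s * v)"
  have cnj: "cnj \<xi> * \<xi> = 1" using \<xi>_norm by (simp add: complex_norm_square[symmetric] mult.commute)
  have "(cmod (1 - of_real s * v))\<^sup>2 = 1 - 2 * (s * Re v) + s\<^sup>2 * (cmod v)\<^sup>2"
    unfolding cmod_power2 by (simp add: power2_eq_square algebra_simps)
  also have "\<dots> \<le> 1 - s * Re v"
    using mult_left_mono[OF s(3), of s] s(1) by (simp add: power2_eq_square mult.assoc)
  also have "\<dots> < 1" using s assms by simp
  finally have "cmod (1 - of_real s * v) < 1"
    by (metis abs_norm_cancel abs_square_less_1)
  then have zD: "z \<in> \<D>" by (simp add: z_def norm_mult \<xi>_norm)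
  have zxi: "z - \<xi> = - (of_real s * (\<xi> * v))" by (simp add: z_def algebra_simps)
  have dist: "cmod (z - \<xi>) = s * cmod v" using s by (simp add: zxi norm_mult \<xi>_norm)
  then have zb: "z \<in> ball \<xi> \<delta>" using s by (simp add: dist_norm norm_minus_commute)
  define e where "e = \<phi> z - \<xi> - d * (z - \<xi>)"
  have e: "cmod e \<le> \<eta> * (s * cmod v)"
    using linear_bound_at_\<xi>[OF \<delta>(2) \<delta>(1), of z] zD zb unfolding e_def dist by blast
  have "cnj \<xi> * \<phi> z = cnj \<xi> * \<xi> - of_real s * (cnj \<xi> * \<xi>) * (d * v) + cnj \<xi> * e"
    by (simp add: e_def zxi algebra_simps)
  then have "Re (cnj \<xi> * \<phi> z) = 1 - s * Re (d * v) + Re (cnj \<xi> * e)"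
    unfolding cnj by simp
  moreover have "Re (cnj \<xi> * e) \<ge> - cmod e"
    using abs_Re_le_cmod[of "cnj \<xi> * e"] by (simp add: norm_mult \<xi>_norm)
  moreover have "\<eta> * (s * cmod v) = - s * Re (d * v) / 2"
    by (subst mult.left_commute, subst \<eta>(2)) (simp add: algebra_simps)
  moreover have "s * Re (d * v) < 0" using s neg by (simp add: mult_pos_neg)
  ultimately have "Re (cnj \<xi> * \<phi> z) > 1" using e by linarith
  moreover have "Re (cnj \<xi> * \<phi> z) \<le> cmod (\<phi> z)"
    using complex_Re_le_cmod[of "cnj \<xi> * \<phi> z"] by (simp add: norm_mult \<xi>_norm)
  ultimately show False using maps[OF zD] by simp
qed

text \<open>Multiplication by d sends the right half-plane into its closure, which forces d to be a
  nonnegative real. If \<open>Im d\<close> were nonzero, the slope (Re d + 1)/Im d would give Re(dv)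
  = -1.\<close>

lemma derivative_real_nonneg: "Im d = 0" "Re d \<ge> 0"
proof -
  show Re: "Re d \<ge> 0" using Re_derivative_direction[of 1] by simp
  show "Im d = 0"
  proof (rule ccontr)
    assume "Im d \<noteq> 0"
    then have "Re (d * Complex 1 ((Re d + 1) / Im d)) = -1" by simp
    with Re_derivative_direction[of "Complex 1 ((Re d + 1) / Im d)"] show False by simp
  qed
qed

text \<open>Compare \<open>\<phi>\<close> at \<open>z\<close> and along the radius from \<open>z\<close> to \<open>z / |z|\<close>: moving outwards changes
  \<open>\<phi>\<close> by about \<open>d (1 - |z|)\<close> in a nearly radial direction, and \<open>\<phi>\<close> stays in the disk.\<close>

lemma one_minus_norm_ge:
  assumes D: "D < Re d"
  shows "\<forall>\<^sub>F z in at \<xi> within \<D>. D * (1 - cmod z) \<le> 1 - cmod (\<phi> z)"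
proof -
  define r where "r = Re d"
  have dr: "d = of_real r" using derivative_real_nonneg by (simp add: r_def complex_eq_iff)
  have r0: "r \<ge> 0" using derivative_real_nonneg by (simp add: r_def)
  define \<eta> where "\<eta> = (r - D) / 2"
  have \<eta>: "\<eta> > 0" using D by (simp add: \<eta>_def r_def)
  \<comment> \<open>The bound on the angle between \<open>sgn (\<phi> z)\<close> and
    \<open>sgn z\<close>, chosen so that r \<kappa> \<le> \<eta>. The denominator r + 1 keeps it
    defined when r = 0.\<close>
  define \<kappa> where "\<kappa> = \<eta> / (r + 1)"
  have \<kappa>: "\<kappa> > 0" "r * \<kappa> \<le> \<eta>" using \<eta> r0 by (simp_all add: \<kappa>_def field_simps)
  obtain \<delta> where \<delta>: "\<delta> > 0" "\<And>z. z \<in> \<D> \<inter> ball \<xi> \<delta> \<Longrightarrow> cmod (deriv \<phi> z - d) \<le> \<eta>"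
    using deriv_near[OF \<eta>] by blast
  have sgn_lim: "((\<lambda>z. sgn z) \<longlongrightarrow> \<xi>) (at \<xi> within \<D>)"
  proof -
    have "((\<lambda>z. sgn z) \<longlongrightarrow> sgn \<xi>) (at \<xi> within \<D>)"
      using \<xi>_norm by (intro tendsto_intros) auto
    then show ?thesis using \<xi>_norm by (simp add: sgn_div_norm)
  qed
  have sgn_lim2: "((\<lambda>z. sgn (\<phi> z)) \<longlongrightarrow> \<xi>) (at \<xi> within \<D>)"
  proof -
    have "((\<lambda>z. sgn (\<phi> z)) \<longlongrightarrow> sgn \<xi>) (at \<xi> within \<D>)"
      using \<xi>_norm by (intro tendsto_intros lim) auto
    then show ?thesis using \<xi>_norm by (simp add: sgn_div_norm)
  qed
  have "((\<lambda>z. sgn (\<phi> z) - sgn z) \<longlongrightarrow> \<xi> - \<xi>) (at \<xi> within \<D>)"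
    by (intro tendsto_intros sgn_lim sgn_lim2)
  then have "\<forall>\<^sub>F z in at \<xi> within \<D>. cmod (sgn (\<phi> z) - sgn z) < \<kappa>"
    using \<kappa>(1) by (auto dest!: tendstoD simp: dist_norm)
  moreover have "\<forall>\<^sub>F z in at \<xi> within \<D>. dist (sgn z) \<xi> < \<delta>"
    using sgn_lim \<delta>(1) by (rule tendstoD)
  moreover have "\<forall>\<^sub>F z in at \<xi> within \<D>. z \<in> \<D> \<inter> ball \<xi> \<delta>"
    using \<delta>(1) by (auto simp: eventually_at_within_disk[OF \<xi>])
  moreover have "\<forall>\<^sub>F z in at \<xi> within \<D>. \<phi> z \<noteq> 0"
    by (rule tendsto_imp_eventually_ne[OF lim \<xi>_ne])
  moreover have "\<forall>\<^sub>F z in at \<xi> within \<D>. z \<noteq> 0"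
    by (rule tendsto_imp_eventually_ne[OF tendsto_ident_at \<xi>_ne])
  ultimately show ?thesis
  proof eventually_elim
    case (elim z)
    define \<zeta> where "\<zeta> = sgn z"
    define \<rho> where "\<rho> = cmod z"
    have z: "z = of_real \<rho> * \<zeta>" "cmod \<zeta> = 1"
      using elim by (simp_all add: \<zeta>_def \<rho>_def sgn_eq norm_divide)
    have \<rho>: "0 < \<rho>" "\<rho> < 1" using elim by (auto simp: \<rho>_def)
    have step: "cmod (\<phi> z + d * of_real (s - \<rho>) * \<zeta>) \<le> 1 + \<eta> * (s - \<rho>)" if s: "\<rho> < s" "s < 1" for s
    proof -
      define y where "y = of_real s * \<zeta>"
      have "y \<in> closed_segment z \<zeta>"
      proof -
        define q where "q = (s - \<rho>) / (1 - \<rho>)"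
        have "q * (1 - \<rho>) = s - \<rho>" using \<rho> by (simp add: q_def)
        then have "s = (1 - q) * \<rho> + q" by (simp add: algebra_simps)
        then have "y = of_real ((1 - q) * \<rho> + q) * \<zeta>" by (simp add: y_def)
        then have "y = (1 - q) *\<^sub>R z + q *\<^sub>R \<zeta>"
          unfolding z(1) scaleR_conv_of_real of_real_add of_real_mult
          by (simp only: distrib_right mult.assoc)
        moreover have "0 \<le> q" "q \<le> 1" using s \<rho> by (simp_all add: q_def)
        ultimately show ?thesis by (auto simp: closed_segment_def)
      qed
      moreover have "closed_segment z \<zeta> \<subseteq> ball \<xi> \<delta>"
        using elim by (intro closed_segment_subset) (auto simp: \<zeta>_def dist_commute)
      ultimately have y: "y \<in> \<D> \<inter> ball \<xi> \<delta>"
        using s \<rho> z by (auto simp: y_def norm_mult)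
      have yz: "y - z = of_real (s - \<rho>) * \<zeta>" by (simp add: y_def z(1) algebra_simps)
      have "cmod (\<phi> y - \<phi> z - d * (y - z)) \<le> \<eta> * cmod (y - z)"
        using linear_bound[OF \<delta>(2) y] elim by simp
      also have "cmod (y - z) = s - \<rho>" unfolding yz norm_mult norm_of_real z(2) using s by simp
      finally have "cmod (\<phi> z + d * (y - z) - \<phi> y) \<le> \<eta> * (s - \<rho>)"
        by (subst (asm) norm_minus_commute) (simp add: algebra_simps)
      moreover have "cmod (\<phi> y) \<le> 1" using maps[of y] y by simp
      ultimately have "cmod (\<phi> z + d * (y - z)) \<le> 1 + \<eta> * (s - \<rho>)"
        using norm_triangle_sub[of "\<phi> z + d * (y - z)" "\<phi> y"] by linarith
      then show ?thesis by (simp add: yz mult.assoc)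
    qed
    \<comment> \<open>The point s \<open>\<zeta>\<close> moves to the circle. The value of \<phi>
      there has been replaced by the bound 1, so no boundary value at \<open>\<zeta>\<close> is
      involved and both sides are continuous in s.\<close>
    have lim1: "cmod (\<phi> z + d * of_real (1 - \<rho>) * \<zeta>) \<le> 1 + \<eta> * (1 - \<rho>)"
    proof (rule tendsto_le[of "at_left 1"])
      show "((\<lambda>s. cmod (\<phi> z + d * of_real (s - \<rho>) * \<zeta>)) \<longlongrightarrow> cmod (\<phi> z + d * of_real (1 - \<rho>) * \<zeta>)) (at_left 1)"
        by (intro tendsto_intros)
      show "((\<lambda>s. 1 + \<eta> * (s - \<rho>)) \<longlongrightarrow> 1 + \<eta> * (1 - \<rho>)) (at_left 1)"
        by (intro tendsto_intros)
      show "\<forall>\<^sub>F s in at_left 1. cmod (\<phi> z + d * of_real (s - \<rho>) * \<zeta>) \<le> 1 + \<eta> * (s - \<rho>)"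
        using eventually_at_left_field[of _ "1::real"] \<rho> step by blast
    qed simp
    define h where "h = r * (1 - \<rho>)"
    have h: "h \<ge> 0" using r0 \<rho> by (simp add: h_def)
    \<comment> \<open>Lengthening \<phi>(z) by h in its own direction is exact for the norm;
      exchanging that direction for \<open>\<zeta>\<close> costs at most h \<kappa>.\<close>
    have "cmod (\<phi> z) + h = cmod (of_real (cmod (\<phi> z) + h) * sgn (\<phi> z))"
      using elim h by (simp add: norm_mult norm_sgn del: of_real_add)
    also have "of_real (cmod (\<phi> z) + h) * sgn (\<phi> z) = \<phi> z + of_real h * sgn (\<phi> z)"
      using elim by (simp add: distrib_right) (simp add: sgn_div_norm scaleR_conv_of_real)
    also have "\<dots> = (\<phi> z + of_real h * \<zeta>) + of_real h * (sgn (\<phi> z) - \<zeta>)"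
      by (simp add: algebra_simps)
    also have "cmod \<dots> \<le> (1 + \<eta> * (1 - \<rho>)) + h * \<kappa>"
    proof -
      have "cmod (\<phi> z + of_real h * \<zeta>) \<le> 1 + \<eta> * (1 - \<rho>)"
        using lim1 by (simp add: h_def dr)
      moreover have "cmod (of_real h * (sgn (\<phi> z) - \<zeta>)) \<le> h * \<kappa>"
        using elim h by (simp add: norm_mult \<zeta>_def mult_left_mono)
      ultimately show ?thesis
        using norm_triangle_ineq[of "\<phi> z + of_real h * \<zeta>" "of_real h * (sgn (\<phi> z) - \<zeta>)"] by linarith
    qed
    also have "h * \<kappa> \<le> \<eta> * (1 - \<rho>)"
      using mult_right_mono[OF \<kappa>(2), of "1 - \<rho>"] \<rho> by (simp add: h_def mult_ac)
    finally have "cmod (\<phi> z) + h \<le> 1 + 2 * \<eta> * (1 - \<rho>)" by simp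
    also have "2 * \<eta> = r - D" by (simp add: \<eta>_def)
    finally show ?case by (simp add: h_def \<rho>_def[symmetric] algebra_simps)
  qed
qed

text \<open>Factor 1 - |z|^2 = (1 - |z|)(1 + |z|). The previous lemma handles the first factor; for
  the second, 1 + |z| is at most 2 while 1 + |\<phi>(z)| tends to 2.\<close>

lemma weight_ratio:
  assumes d0: "Re d > 0" and R: "R > 1 / Re d"
  shows "\<forall>\<^sub>F z in at \<xi> within \<D>. 1 - (cmod z)\<^sup>2 \<le> R * (1 - (cmod (\<phi> z))\<^sup>2)"
proof -
  \<comment> \<open>The midpoint between 1/R and d: it is below d, and RD > 1 absorbs the difference
    between 1 + |\<phi>(z)| and 2.\<close>
  define D where "D = (1 / R + Re d) / 2"
  have R0: "R > 0" using R d0 by (smt (verit) divide_pos_pos)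
  have "1 / R < Re d" using R d0 R0 by (simp add: field_simps)
  then have D: "D < Re d" "1 / R < D" by (simp_all add: D_def)
  have RD: "R * D > 1" using D(2) R0 by (simp add: field_simps)
  have D0: "D > 0" using D(2) R0 by (smt (verit) divide_pos_pos)
  have "((\<lambda>z. R * D * (1 + cmod (\<phi> z))) \<longlongrightarrow> R * D * (1 + cmod \<xi>)) (at \<xi> within \<D>)"
    by (intro tendsto_intros lim)
  then have "\<forall>\<^sub>F z in at \<xi> within \<D>. 2 < R * D * (1 + cmod (\<phi> z))"
    using RD \<xi>_norm by (intro order_tendstoD) auto
  moreover have "\<forall>\<^sub>F z in at \<xi> within \<D>. z \<in> \<D>"
    by (auto simp: eventually_at_within_disk[OF \<xi>] intro: exI[of _ 1])
  ultimately show ?thesis using one_minus_norm_ge[OF D(1)]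
  proof eventually_elim
    case (elim z)
    have "1 - (cmod z)\<^sup>2 = (1 - cmod z) * (1 + cmod z)" by (simp add: power2_eq_square algebra_simps)
    also have "\<dots> \<le> (1 - cmod z) * (R * D * (1 + cmod (\<phi> z)))"
      using elim by (intro mult_left_mono) auto
    also have "\<dots> = R * ((D * (1 - cmod z)) * (1 + cmod (\<phi> z)))" by simp
    also have "\<dots> \<le> R * ((1 - cmod (\<phi> z)) * (1 + cmod (\<phi> z)))"
      using elim R0 by (intro mult_left_mono mult_right_mono) auto
    also have "\<dots> = R * (1 - (cmod (\<phi> z))\<^sup>2)" by (simp add: power2_eq_square algebra_simps)
    finally show ?case .
  qed
qed

lemma difference_quotient_tendsto:
  "((\<lambda>z. cmod (\<xi> - \<phi> z) / cmod (\<xi> - z)) \<longlongrightarrow> cmod d) (at \<xi> within \<D>)"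
proof (rule tendstoI)
  fix e :: real assume e: "e > 0"
  obtain \<delta> where \<delta>: "\<delta> > 0" "\<And>z. z \<in> \<D> \<inter> ball \<xi> \<delta> \<Longrightarrow> cmod (deriv \<phi> z - d) \<le> e / 2"
    using deriv_near[of "e / 2"] e by auto
  have "dist (cmod (\<xi> - \<phi> z) / cmod (\<xi> - z)) (cmod d) < e" if z: "z \<in> \<D> \<inter> ball \<xi> \<delta>" for z
  proof -
    have ne: "cmod (\<xi> - z) > 0" using z \<xi> by auto
    have "\<bar>cmod (\<xi> - \<phi> z) - cmod (d * (\<xi> - z))\<bar> \<le> cmod ((\<xi> - \<phi> z) - d * (\<xi> - z))"
      by (rule norm_triangle_ineq3)
    also have "(\<xi> - \<phi> z) - d * (\<xi> - z) = - (\<phi> z - \<xi> - d * (z - \<xi>))" by (simp add: algebra_simps)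
    also have "cmod \<dots> \<le> e / 2 * cmod (\<xi> - z)"
      using linear_bound_at_\<xi>[OF \<delta>(2) \<delta>(1) z] unfolding norm_minus_cancel
      by (simp add: norm_minus_commute[of z \<xi>])
    also have "\<dots> < e * cmod (\<xi> - z)" using ne e by simp
    finally have "\<bar>cmod (\<xi> - \<phi> z) - cmod d * cmod (\<xi> - z)\<bar> < e * cmod (\<xi> - z)"
      by (simp add: norm_mult)
    then show ?thesis using ne by (auto simp: dist_real_def abs_less_iff field_simps)
  qed
  then show "\<forall>\<^sub>F z in at \<xi> within \<D>. dist (cmod (\<xi> - \<phi> z) / cmod (\<xi> - z)) (cmod d) < e"
    using \<delta>(1) by (auto simp: eventually_at_within_disk[OF \<xi>])
qed

end

section \<open>Weakly null sequences: change of variables near \<xi>, dominated convergence away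
  from it\<close>

lemma measurable_indicator_dA:
  "A \<in> sets borel \<Longrightarrow> (\<lambda>z. indicator A z :: ennreal) \<in> borel_measurable (dA \<alpha>)"
  by (simp add: sets_dA measurable_restrict_space1 cong: measurable_cong_sets)

context boundary_fixed
begin

text \<open>After the substitution w = \<phi>(z), the local bounds a for |u|, R for (1 - |z|^2)/(1 -
  |\<phi>(z)|^2) and m for |\<phi>'| from below combine to the factor a^p R^\<alpha> / m^2. One
  radius \<delta> serves all f.\<close>

lemma near_nn_integral_le:
  assumes d0: "Re d > 0" and p: "p > 0" and \<alpha>: "\<alpha> \<ge> 0"
    and u: "u holomorphic_on \<D>" and u0: "(u \<longlongrightarrow> u0) (at \<xi> within \<D>)"
    and K: "cmod u0 powr p * Re d powr -(2 + \<alpha>) < K"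
  obtains \<delta> where "\<delta> > 0"
    "\<And>f. f \<in> bergman p \<alpha> \<Longrightarrow>
      (\<integral>\<^sup>+z\<in>ball \<xi> \<delta>. ennreal (cmod (u z * f (\<phi> z)) powr p) \<partial>dA \<alpha>) \<le> ennreal (K * bergman_norm p \<alpha> f powr p)"
proof -
  \<comment> \<open>The factor obtained when u, the ratio and \<phi>' are known up to \<eta>. As
    \<eta> decreases to 0 it tends to the sharp constant, so a suitable \<eta> brings it below
    K.\<close>
  let ?B = "\<lambda>\<eta>. (cmod u0 + \<eta>) powr p * (1 / Re d + \<eta>) powr \<alpha> / (Re d - \<eta>)\<^sup>2"
  have "(?B \<longlongrightarrow> (cmod u0 + 0) powr p * (1 / Re d + 0) powr \<alpha> / (Re d - 0)\<^sup>2) (at_right 0)"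
    using d0 p by (intro tendsto_intros tendsto_powr') (auto intro: eventually_at_right_less[THEN eventually_mono])
  also have "(cmod u0 + 0) powr p * (1 / Re d + 0) powr \<alpha> / (Re d - 0)\<^sup>2 = cmod u0 powr p * Re d powr -(2 + \<alpha>)"
  proof -
    have "Re d powr -(2 + \<alpha>) = inverse (Re d powr 2 * Re d powr \<alpha>)"
      by (simp only: powr_minus powr_add)
    then show ?thesis using d0 by (simp add: powr_divide divide_simps) (simp add: mult_ac)
  qed
  finally have "\<forall>\<^sub>F \<eta> in at_right 0. ?B \<eta> < K" using K by (rule order_tendstoD)
  moreover have "\<forall>\<^sub>F \<eta> in at_right 0. \<eta> < Re d"
    using eventually_at_right_real[OF d0] by eventually_elim simp
  moreover have "\<forall>\<^sub>F \<eta> in at_right 0. (0::real) < \<eta>" by (rule eventually_at_right_less)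
  ultimately have "\<forall>\<^sub>F \<eta> in at_right 0. ?B \<eta> < K \<and> \<eta> < Re d \<and> 0 < \<eta>"
    by eventually_elim simp
  then obtain \<eta> where \<eta>: "?B \<eta> < K" "\<eta> < Re d" "0 < \<eta>"
    using eventually_happens trivial_limit_at_right_real by blast
  define a R m where "a = cmod u0 + \<eta>" and "R = 1 / Re d + \<eta>" and "m = Re d - \<eta>"
  have m: "m > 0" using \<eta> by (simp add: m_def)
  have R: "R > 0" using \<eta> d0 by (simp add: R_def add_pos_pos)
  have a: "a > 0" using \<eta> by (simp add: a_def add_nonneg_pos)
  have B: "a powr p * R powr \<alpha> / m\<^sup>2 < K" using \<eta>(1) by (simp add: a_def R_def m_def)
  have K0: "K > 0" using B m by (smt (verit) divide_nonneg_pos mult_nonneg_nonneg powr_ge_zero zero_less_power)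
  have "\<forall>\<^sub>F z in at \<xi> within \<D>. dist (u z) u0 < \<eta>"
    using u0 \<eta>(3) by (rule tendstoD)
  moreover have "\<forall>\<^sub>F z in at \<xi> within \<D>. dist (deriv \<phi> z) d < \<eta>"
    using lim_deriv \<eta>(3) by (rule tendstoD)
  moreover have "\<forall>\<^sub>F z in at \<xi> within \<D>. 1 - (cmod z)\<^sup>2 \<le> R * (1 - (cmod (\<phi> z))\<^sup>2)"
    using d0 \<eta> by (intro weight_ratio) (auto simp: R_def)
  ultimately have "\<forall>\<^sub>F z in at \<xi> within \<D>. dist (u z) u0 < \<eta> \<and> dist (deriv \<phi> z) d < \<eta> \<and>
      1 - (cmod z)\<^sup>2 \<le> R * (1 - (cmod (\<phi> z))\<^sup>2)"
    by eventually_elim simp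
  then obtain \<delta> where \<delta>: "\<delta> > 0" and near: "\<And>z. z \<in> \<D> \<inter> ball \<xi> \<delta> \<Longrightarrow> dist (u z) u0 < \<eta> \<and>
      dist (deriv \<phi> z) d < \<eta> \<and> 1 - (cmod z)\<^sup>2 \<le> R * (1 - (cmod (\<phi> z))\<^sup>2)"
    unfolding eventually_at_within_disk[OF \<xi>] by blast
  define U where "U = \<D> \<inter> ball \<xi> \<delta>"
  have U: "open U" "U \<subseteq> \<D>" by (auto simp: U_def)
  have dnear: "cmod (deriv \<phi> z - d) \<le> \<eta>" if "z \<in> \<D> \<inter> ball \<xi> \<delta>" for z
    using near[OF that] by (simp add: dist_norm)
  have dnorm: "cmod d = Re d"
    using derivative_real_nonneg by (simp add: cmod_def)
  \<comment> \<open>Equal values at x and y would give d |x - y| \<le> \<eta> |x - y| with \<eta> <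
    d.\<close>
  have inj: "inj_on \<phi> U"
  proof (rule inj_onI)
    fix x y :: complex assume xy: "x \<in> U" "y \<in> U" "\<phi> x = \<phi> y"
    have "cmod (\<phi> x - \<phi> y - d * (x - y)) \<le> \<eta> * cmod (x - y)"
      using linear_bound[OF dnear, where z=x and w=y] xy unfolding U_def by blast
    then have "Re d * cmod (x - y) \<le> \<eta> * cmod (x - y)"
      using xy(3) by (simp add: norm_mult dnorm)
    then show "x = y" using \<eta>(2) by (auto simp: mult_le_cancel_right)
  qed
  have md: "m \<le> cmod (deriv \<phi> z)" if "z \<in> U" for z
  proof -
    have "cmod d \<le> cmod (deriv \<phi> z) + cmod (deriv \<phi> z - d)"
      by (metis norm_triangle_sub norm_minus_commute)
    then show ?thesis using dnear[of z] that dnorm by (simp add: m_def U_def)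
  qed
  have ua: "cmod (u z) \<le> a" if "z \<in> U" for z
    using near[of z] that norm_triangle_sub[of "u z" u0] by (simp add: a_def U_def dist_norm)
  have wR: "bergman_weight \<alpha> z \<le> R powr \<alpha> * bergman_weight \<alpha> (\<phi> z)" if "z \<in> U" for z
  proof -
    have zD: "z \<in> \<D>" using that U by auto
    have sq: "(cmod z)\<^sup>2 \<le> 1" "(cmod (\<phi> z))\<^sup>2 \<le> 1"
      using zD maps[OF zD] by (auto simp: power_le_one)
    have "(1 - (cmod z)\<^sup>2) powr \<alpha> \<le> (R * (1 - (cmod (\<phi> z))\<^sup>2)) powr \<alpha>"
      using near[of z] that sq \<alpha> by (intro powr_mono2) (auto simp: U_def)
    also have "\<dots> = R powr \<alpha> * (1 - (cmod (\<phi> z))\<^sup>2) powr \<alpha>"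
      using R sq by (intro powr_mult)
    finally have "(1 + \<alpha>) * (1 - (cmod z)\<^sup>2) powr \<alpha> / pi \<le>
      (1 + \<alpha>) * (R powr \<alpha> * (1 - (cmod (\<phi> z))\<^sup>2) powr \<alpha>) / pi"
      using \<alpha> by (intro divide_right_mono mult_left_mono) auto
    then show ?thesis by (simp add: bergman_weight_def mult_ac)
  qed
  have "(\<integral>\<^sup>+z\<in>ball \<xi> \<delta>. ennreal (cmod (u z * f (\<phi> z)) powr p) \<partial>dA \<alpha>) \<le> ennreal (K * bergman_norm p \<alpha> f powr p)"
    if f: "f \<in> bergman p \<alpha>" for f
  proof -
    define h where "h w = ennreal (bergman_weight \<alpha> w * cmod (f w) powr p) * indicator \<D> w" for w
    have fh: "f holomorphic_on \<D>" using bergmanD(1)[OF f] .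
    have f_meas [measurable]: "f \<in> borel_measurable (dA \<alpha>)" using fh by (rule holomorphic_measurable_dA)
    \<comment> \<open>Off the disk f is an arbitrary function. Cutting it off inside the formula
      makes h visibly Borel measurable on the plane.\<close>
    have h_eq: "h w = ennreal (bergman_weight \<alpha> w * cmod (indicator \<D> w *\<^sub>R f w) powr p) * indicator \<D> w" for w
      by (simp add: h_def indicator_def)
    have [measurable]: "(\<lambda>w. indicator \<D> w *\<^sub>R f w) \<in> borel_measurable borel"
      by (intro borel_measurable_continuous_on_indicator holomorphic_on_imp_continuous_on fh) auto
    have [measurable]: "\<D> \<in> sets borel" "ball \<xi> \<delta> \<in> sets borel" "U \<in> sets borel" using U by auto
    have h_meas: "h \<in> borel_measurable borel"
      unfolding h_eq by measurable
    have hint: "(\<integral>\<^sup>+w. h w \<partial>lborel) = ennreal (bergman_norm p \<alpha> f powr p)"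
    proof -
      have "ennreal (bergman_norm p \<alpha> f powr p) = (\<integral>\<^sup>+z. ennreal (cmod (f z) powr p) \<partial>dA \<alpha>)"
        using nn_integral_bergman[OF f p] by simp
      also have "\<dots> = (\<integral>\<^sup>+z\<in>\<D>. ennreal (bergman_weight \<alpha> z) * ennreal (cmod (f z) powr p) \<partial>lborel)"
        by (intro nn_integral_dA) measurable
      also have "\<dots> = (\<integral>\<^sup>+w. h w \<partial>lborel)"
        using bergman_weight_nonneg[OF \<alpha>]
        by (intro nn_integral_cong) (simp add: h_def ennreal_mult[symmetric])
      finally show ?thesis by simp
    qed
    have fp: "(\<lambda>z. f (\<phi> z)) holomorphic_on \<D>"
      using holomorphic_on_compose_gen[OF holo fh] maps by (auto simp: o_def image_subset_iff)
    have mm: "(\<lambda>z. ennreal (cmod (u z * f (\<phi> z)) powr p) * indicator (ball \<xi> \<delta>) z) \<in> borel_measurable (dA \<alpha>)"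
    proof -
      have [measurable]: "u \<in> borel_measurable (dA \<alpha>)" "(\<lambda>z. f (\<phi> z)) \<in> borel_measurable (dA \<alpha>)"
        using u fp by (auto intro: holomorphic_measurable_dA)
      have [measurable]: "(\<lambda>z. indicator (ball \<xi> \<delta>) z :: ennreal) \<in> borel_measurable (dA \<alpha>)"
        by (rule measurable_indicator_dA) simp
      show ?thesis by measurable
    qed
    have "(\<integral>\<^sup>+z\<in>ball \<xi> \<delta>. ennreal (cmod (u z * f (\<phi> z)) powr p) \<partial>dA \<alpha>) =
        (\<integral>\<^sup>+z\<in>\<D>. ennreal (bergman_weight \<alpha> z) * (ennreal (cmod (u z * f (\<phi> z)) powr p) * indicator (ball \<xi> \<delta>) z) \<partial>lborel)"
      by (rule nn_integral_dA[OF mm])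
    also have "\<dots> \<le> (\<integral>\<^sup>+z. ennreal (a powr p * R powr \<alpha>) * (h (\<phi> z) * indicator U z) \<partial>lborel)"
    proof (intro nn_integral_mono)
      fix z
      show "ennreal (bergman_weight \<alpha> z) * (ennreal (cmod (u z * f (\<phi> z)) powr p) * indicator (ball \<xi> \<delta>) z)
        * indicator \<D> z \<le> ennreal (a powr p * R powr \<alpha>) * (h (\<phi> z) * indicator U z)"
      proof (cases "z \<in> U")
        case True
        have "bergman_weight \<alpha> z * cmod (u z * f (\<phi> z)) powr p \<le>
            (R powr \<alpha> * bergman_weight \<alpha> (\<phi> z)) * (a powr p * cmod (f (\<phi> z)) powr p)"
          using wR[OF True] ua[OF True] p bergman_weight_nonneg[OF \<alpha>]
          by (intro mult_mono) (auto simp: norm_mult powr_mult intro!: mult_right_mono powr_mono2)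
        moreover have "\<phi> z \<in> \<D>" using True U maps by auto
        ultimately show ?thesis
          using True bergman_weight_nonneg[OF \<alpha>]
          by (simp add: h_def U_def ennreal_mult[symmetric] mult_ac)
      qed (auto simp: U_def indicator_def)
    qed
    also have "\<dots> = ennreal (a powr p * R powr \<alpha>) * (\<integral>\<^sup>+z\<in>U. h (\<phi> z) \<partial>lborel)"
    proof (rule nn_integral_cmult)
      have "(\<lambda>z. indicator U z *\<^sub>R \<phi> z) \<in> borel_measurable borel"
        using U holo by (intro borel_measurable_continuous_on_indicator holomorphic_on_imp_continuous_on)
          (auto intro: holomorphic_on_subset)
      then have "(\<lambda>z. h (indicator U z *\<^sub>R \<phi> z) * indicator U z) \<in> borel_measurable borel"
        using h_meas by measurable
      moreover have "(\<lambda>z. h (indicator U z *\<^sub>R \<phi> z) * indicator U z) = (\<lambda>z. h (\<phi> z) * indicator U z)"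
        by (auto simp: indicator_def fun_eq_iff)
      ultimately show "(\<lambda>z. h (\<phi> z) * indicator U z) \<in> borel_measurable lborel" by simp
    qed
    also have "\<dots> = ennreal (a powr p * R powr \<alpha> / m\<^sup>2) * (ennreal (m\<^sup>2) * (\<integral>\<^sup>+z\<in>U. h (\<phi> z) \<partial>lborel))"
      using m by (simp add: mult.assoc[symmetric] ennreal_mult[symmetric])
    also have "\<dots> \<le> ennreal (a powr p * R powr \<alpha> / m\<^sup>2) * (\<integral>\<^sup>+w. h w \<partial>lborel)"
      using m md U holo inj h_meas
      by (intro mult_left_mono nn_integral_holomorphic_le) (auto intro: holomorphic_on_subset)
    also have "\<dots> \<le> ennreal K * ennreal (bergman_norm p \<alpha> f powr p)"
      unfolding hint using B by (intro mult_right_mono ennreal_leI) auto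
    also have "\<dots> = ennreal (K * bergman_norm p \<alpha> f powr p)"
      using K0 by (simp add: ennreal_mult)
    finally show ?thesis .
  qed
  with \<delta> show ?thesis by (rule that)
qed

end

text \<open>The closure is compact in the closed disk, so the modulus attains its maximum there, and
  this maximum is not 1. It makes the images of points away from \<xi> stay in a fixed smaller
  disk.\<close>

lemma closure_avoiding_sphere:
  fixes A :: "complex set"
  assumes "A \<subseteq> \<D>" "closure A \<inter> sphere 0 1 = {}"
  obtains \<rho> where "0 \<le> \<rho>" "\<rho> < 1" "A \<subseteq> cball 0 \<rho>"
proof (cases "A = {}")
  case True
  then show ?thesis using that[of 0] by simp
next
  case False
  have sub: "closure A \<subseteq> cball 0 1"
    using assms(1) by (intro closure_minimal) (auto simp: less_imp_le subset_iff)
  then have "compact (closure A)"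
    by (metis bounded_cball bounded_subset closed_closure compact_eq_bounded_closed)
  then obtain z where z: "z \<in> closure A" "\<And>w. w \<in> closure A \<Longrightarrow> cmod w \<le> cmod z"
    using continuous_attains_sup[of "closure A" cmod] False continuous_on_norm_id by auto
  have "cmod z < 1" using z(1) assms(2) sub by (force simp: less_le)
  then show ?thesis
    using that[of "cmod z"] z(2) closure_subset[of A] by (auto simp: subset_iff)
qed

lemma wcomp_bergman:
  "wcomp u \<phi> \<in> bergman_ops p \<alpha> \<Longrightarrow> f \<in> bergman p \<alpha> \<Longrightarrow> wcomp u \<phi> f \<in> bergman p \<alpha>"
  by (auto simp: bergman_ops_def)

lemma nn_integral_split_ball:
  assumes "g \<in> borel_measurable (dA \<alpha>)"
  shows "(\<integral>\<^sup>+z. g z \<partial>dA \<alpha>) = (\<integral>\<^sup>+z\<in>ball \<xi> \<delta>. g z \<partial>dA \<alpha>) + (\<integral>\<^sup>+z\<in>- ball \<xi> \<delta>. g z \<partial>dA \<alpha>)"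
proof -
  have "(\<integral>\<^sup>+z. g z \<partial>dA \<alpha>) = (\<integral>\<^sup>+z. g z * indicator (ball \<xi> \<delta>) z + g z * indicator (- ball \<xi> \<delta>) z \<partial>dA \<alpha>)"
    by (intro nn_integral_cong) (auto simp: indicator_def)
  also have "\<dots> = (\<integral>\<^sup>+z\<in>ball \<xi> \<delta>. g z \<partial>dA \<alpha>) + (\<integral>\<^sup>+z\<in>- ball \<xi> \<delta>. g z \<partial>dA \<alpha>)"
    using assms by (intro nn_integral_add) (auto intro!: borel_measurable_times_ennreal measurable_indicator_dA)
  finally show ?thesis .
qed

text \<open>Outside the ball \<phi> takes values in |w| \<le> \<rho>, where all functions of norm 1
  are bounded by one constant C. Hence C^p |u|^p is an integrable majorant, and pointwise
  convergence suffices instead of uniform convergence on compact sets.\<close>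

lemma weakly_null_away_tendsto:
  assumes p: "p > 1" and \<alpha>: "\<alpha> \<ge> 0"
    and u: "u \<in> bergman p \<alpha>" and \<phi>: "\<phi> holomorphic_on \<D>" "\<And>z. z \<in> \<D> \<Longrightarrow> \<phi> z \<in> \<D>"
    and \<rho>: "0 \<le> \<rho>" "\<rho> < 1" "\<And>z. z \<in> \<D> - ball \<xi> \<delta> \<Longrightarrow> cmod (\<phi> z) \<le> \<rho>"
    and f: "f \<in> weakly_null_unit_seqs p \<alpha>"
  shows "(\<lambda>n. \<integral>\<^sup>+z\<in>- ball \<xi> \<delta>. ennreal (cmod (u z * f n (\<phi> z)) powr p) \<partial>dA \<alpha>) \<longlonglongrightarrow> 0"
proof -
  have fn: "f n \<in> bergman p \<alpha>" "bergman_norm p \<alpha> (f n) = 1" for n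
    using f by (auto simp: weakly_null_unit_seqs_def)
  obtain C where C: "C > 0"
    "\<And>f w. f \<in> bergman p \<alpha> \<Longrightarrow> cmod w \<le> \<rho> \<Longrightarrow> cmod (f w) \<le> C * bergman_norm p \<alpha> f"
    using bergman_point_bound[OF p \<alpha> \<rho>(1,2)] by blast
  have [measurable]: "(\<lambda>z::complex. indicator (- ball \<xi> \<delta>) z :: ennreal) \<in> borel_measurable (dA \<alpha>)"
    by (intro measurable_indicator_dA) auto
  have uh: "u holomorphic_on \<D>" using bergmanD(1)[OF u] .
  have [measurable]: "u \<in> borel_measurable (dA \<alpha>)" using uh by (rule holomorphic_measurable_dA)
  have [measurable]: "(\<lambda>z. f n (\<phi> z)) \<in> borel_measurable (dA \<alpha>)" for n
    using holomorphic_on_compose_gen[OF \<phi>(1) bergmanD(1)[OF fn(1)[of n]]] \<phi>(2)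
    by (intro holomorphic_measurable_dA) (auto simp: o_def image_subset_iff)
  have "(\<lambda>n. \<integral>\<^sup>+z\<in>- ball \<xi> \<delta>. ennreal (cmod (u z * f n (\<phi> z)) powr p) \<partial>dA \<alpha>) \<longlonglongrightarrow> (\<integral>\<^sup>+z. 0 \<partial>dA \<alpha>)"
  proof (rule nn_integral_dominated_convergence[where w="\<lambda>z. ennreal (C powr p) * ennreal (cmod (u z) powr p)"])
    show "AE z in dA \<alpha>. ennreal (cmod (u z * f n (\<phi> z)) powr p) * indicator (- ball \<xi> \<delta>) z
        \<le> ennreal (C powr p) * ennreal (cmod (u z) powr p)" for n
    proof (rule AE_I2)
      fix z assume "z \<in> space (dA \<alpha>)"
      then have z: "z \<in> \<D>" by simp
      show "ennreal (cmod (u z * f n (\<phi> z)) powr p) * indicator (- ball \<xi> \<delta>) z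
        \<le> ennreal (C powr p) * ennreal (cmod (u z) powr p)"
      proof (cases "z \<in> ball \<xi> \<delta>")
        case False
        have "cmod (f n (\<phi> z)) \<le> C"
          using C(2)[OF fn(1)[of n] \<rho>(3)[of z]] z False fn(2)[of n] by simp
        then have "cmod (u z * f n (\<phi> z)) powr p \<le> C powr p * cmod (u z) powr p"
          using p by (auto simp: norm_mult powr_mult mult.commute[of "C powr p"]
            intro!: mult_left_mono powr_mono2)
        then show ?thesis using False by (simp add: ennreal_mult[symmetric])
      qed simp
    qed
    have "(\<integral>\<^sup>+z. ennreal (C powr p) * ennreal (cmod (u z) powr p) \<partial>dA \<alpha>) =
        ennreal (C powr p) * ennreal (bergman_norm p \<alpha> u powr p)"
      using nn_integral_bergman[OF u] p by (subst nn_integral_cmult) auto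
    also have "\<dots> < \<infinity>" by (simp add: ennreal_mult_less_top)
    finally show "(\<integral>\<^sup>+z. ennreal (C powr p) * ennreal (cmod (u z) powr p) \<partial>dA \<alpha>) < \<infinity>" .
    show "AE z in dA \<alpha>. (\<lambda>n. ennreal (cmod (u z * f n (\<phi> z)) powr p) * indicator (- ball \<xi> \<delta>) z) \<longlonglongrightarrow> 0"
    proof (rule AE_I2)
      fix z assume "z \<in> space (dA \<alpha>)"
      then have "(\<lambda>n. f n (\<phi> z)) \<longlonglongrightarrow> 0"
        using weakly_null_pointwise[OF p \<alpha> f] \<phi>(2) by simp
      then have "(\<lambda>n. cmod (u z * f n (\<phi> z)) powr p) \<longlonglongrightarrow> cmod (u z * 0) powr p"
        using p by (intro tendsto_intros tendsto_powr') auto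
      then have lim: "(\<lambda>n. ennreal (cmod (u z * f n (\<phi> z)) powr p)) \<longlonglongrightarrow> 0"
        using tendsto_ennrealI by fastforce
      show "(\<lambda>n. ennreal (cmod (u z * f n (\<phi> z)) powr p) * indicator (- ball \<xi> \<delta>) z) \<longlonglongrightarrow> 0"
        using lim by (cases "z \<in> ball \<xi> \<delta>") auto
    qed
  qed auto
  then show ?thesis by simp
qed

lemma (in boundary_fixed) weakly_null_limsup_le:
  assumes d0: "Re d > 0" and p: "p > 1" and \<alpha>: "\<alpha> \<ge> 0"
    and u: "u \<in> bergman p \<alpha>" and u0: "(u \<longlongrightarrow> u0) (at \<xi> within \<D>)"
    and op: "wcomp u \<phi> \<in> bergman_ops p \<alpha>"
    and away: "\<And>\<epsilon>. \<epsilon> > 0 \<Longrightarrow> closure (\<phi> ` (\<D> - ball \<xi> \<epsilon>)) \<inter> sphere 0 1 = {}"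
    and f: "f \<in> weakly_null_unit_seqs p \<alpha>"
  shows "limsup (\<lambda>n. ereal (bergman_norm p \<alpha> (wcomp u \<phi> (f n)))) \<le>
    ereal (cmod u0 * Re d powr - ((2 + \<alpha>) / p))"
proof -
  define L where "L = cmod u0 * Re d powr - ((2 + \<alpha>) / p)"
  have L0: "L \<ge> 0" by (simp add: L_def)
  have Lp: "L powr p = cmod u0 powr p * Re d powr - (2 + \<alpha>)"
    using p by (simp add: L_def powr_mult powr_powr)
  have fn: "f n \<in> bergman p \<alpha>" "bergman_norm p \<alpha> (f n) = 1" for n
    using f by (auto simp: weakly_null_unit_seqs_def)
  have "limsup (\<lambda>n. ereal (bergman_norm p \<alpha> (wcomp u \<phi> (f n)))) \<le> ereal L + ereal e" if e: "e > 0" for e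
  proof -
    have "L powr p < (L + e) powr p" using L0 e p by (intro powr_less_mono2) auto
    \<comment> \<open>The gap between L^p and (L + e)^p is shared: K bounds the part near \<xi> for
      every n, and the remainder (L + e)^p - K is left for the vanishing part. The choice of K
      determines \<delta>, and \<delta> determines \<rho>.\<close>
    then obtain K where K: "L powr p < K" "K < (L + e) powr p" using dense by blast
    have K0: "K > 0" using K(1) by (rule order.strict_trans1[rotated]) simp
    obtain \<delta> where \<delta>: "\<delta> > 0"
      "\<And>f. f \<in> bergman p \<alpha> \<Longrightarrow>
      (\<integral>\<^sup>+z\<in>ball \<xi> \<delta>. ennreal (cmod (u z * f (\<phi> z)) powr p) \<partial>dA \<alpha>) \<le> ennreal (K * bergman_norm p \<alpha> f powr p)"
      using near_nn_integral_le[OF d0 _ \<alpha> bergmanD(1)[OF u] u0, of p K] p K(1) Lp by auto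
    obtain \<rho> where \<rho>: "0 \<le> \<rho>" "\<rho> < 1" "\<phi> ` (\<D> - ball \<xi> \<delta>) \<subseteq> cball 0 \<rho>"
      using closure_avoiding_sphere[of "\<phi> ` (\<D> - ball \<xi> \<delta>)"] maps away[OF \<delta>(1)] by blast
    let ?E = "\<lambda>n. \<integral>\<^sup>+z\<in>- ball \<xi> \<delta>. ennreal (cmod (u z * f n (\<phi> z)) powr p) \<partial>dA \<alpha>"
    have "?E \<longlonglongrightarrow> 0"
      using \<rho> by (intro weakly_null_away_tendsto[OF p \<alpha> u holo maps \<rho>(1,2) _ f])
        (auto simp: image_subset_iff)
    then have "\<forall>\<^sub>F n in sequentially. ?E n < ennreal ((L + e) powr p - K)"
      using K by (intro order_tendstoD) auto
    then have "\<forall>\<^sub>F n in sequentially. ereal (bergman_norm p \<alpha> (wcomp u \<phi> (f n))) \<le> ereal (L + e)"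
    proof eventually_elim
      case (elim n)
      let ?g = "\<lambda>z. ennreal (cmod (u z * f n (\<phi> z)) powr p)"
      have w: "wcomp u \<phi> (f n) \<in> bergman p \<alpha>" using wcomp_bergman[OF op fn(1)] .
      have meas: "?g \<in> borel_measurable (dA \<alpha>)"
        using holomorphic_measurable_dA[OF bergmanD(1)[OF w]] unfolding wcomp_def by measurable
      have "ennreal (bergman_norm p \<alpha> (wcomp u \<phi> (f n)) powr p) = (\<integral>\<^sup>+z. ?g z \<partial>dA \<alpha>)"
        using nn_integral_bergman[OF w] p by (simp add: wcomp_def)
      also have "\<dots> = (\<integral>\<^sup>+z\<in>ball \<xi> \<delta>. ?g z \<partial>dA \<alpha>) + ?E n"
        by (rule nn_integral_split_ball[OF meas])
      also have "\<dots> \<le> ennreal K + ennreal ((L + e) powr p - K)"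
        using \<delta>(2)[OF fn(1)[of n]] fn(2)[of n] elim by (intro add_mono) auto
      also have "\<dots> = ennreal ((L + e) powr p)"
        using K K0 by (simp add: ennreal_plus[symmetric] del: ennreal_plus)
      finally have "bergman_norm p \<alpha> (wcomp u \<phi> (f n)) powr p \<le> (L + e) powr p" by simp
      then have "bergman_norm p \<alpha> (wcomp u \<phi> (f n)) \<le> L + e"
        using powr_less_mono2[of p "L + e" "bergman_norm p \<alpha> (wcomp u \<phi> (f n))"] p L0 e by linarith
      then show ?case by simp
    qed
    from Limsup_bounded[OF this] show ?thesis by simp
  qed
  then show ?thesis unfolding L_def by (rule ereal_le_epsilon2)
qed

subsection \<open>Norms of the test functions\<close>

lemma le_suminf_ennreal:
  fixes f :: "nat \<Rightarrow> ennreal"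
  shows "f k \<le> suminf f"
  using sum_le_suminf[of f "{k}"] by simp

text \<open>Dyadic decomposition: where |\<xi> - z| is between 2^(-k) and 2 * 2^(-k) the integrand
  is at most \<open>a k\<close>, and the areas make the sum geometric with ratio 2^s / 4 < 1. Using
  whole balls instead of annuli only enlarges the sum.\<close>

lemma nn_integral_singularity_finite:
  fixes \<xi> :: complex
  assumes s: "0 < s" "s < 2"
  shows "(\<integral>\<^sup>+z\<in>ball \<xi> 2. ennreal (cmod (\<xi> - z) powr - s) \<partial>lborel) < \<infinity>"
proof -
  define a where "a k = ((1 / 2) ^ k :: real) powr - s" for k
  define q where "q = 2 powr s / 4"
  have q: "0 \<le> q" "q < 1"
    using powr_less_mono[of s 2 2] s by (simp_all add: q_def)
  have a_eq: "a k * (pi * (2 * (1 / 2) ^ k)\<^sup>2) = 4 * pi * q ^ k" for k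
  proof -
    have "(1 / 2) ^ k = 2 powr - real k"
      by (simp add: powr_minus powr_realpow power_one_over inverse_eq_divide)
    then have "a k = (2 powr s) powr real k" by (simp add: a_def powr_powr mult.commute)
    also have "\<dots> = (2 powr s) ^ k" by (simp add: powr_realpow)
    finally have "a k = (2 powr s) ^ k" .
    moreover have "((1 / 2) ^ k)\<^sup>2 = (1 / 4 :: real) ^ k"
      by (simp add: power_mult_distrib[symmetric] power2_eq_square)
    ultimately show ?thesis
      by (simp add: q_def power_mult_distrib power_divide)
  qed
  have "(\<integral>\<^sup>+z\<in>ball \<xi> 2. ennreal (cmod (\<xi> - z) powr - s) \<partial>lborel) \<le>
      (\<integral>\<^sup>+z. (\<Sum>k. ennreal (a k) * indicator (ball \<xi> (2 * (1 / 2) ^ k)) z) \<partial>lborel)"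
  proof (intro nn_integral_mono)
    fix z
    let ?f = "\<lambda>k. ennreal (a k) * indicator (ball \<xi> (2 * (1 / 2) ^ k)) z"
    show "ennreal (cmod (\<xi> - z) powr - s) * indicator (ball \<xi> 2) z \<le> (\<Sum>k. ?f k)"
    proof (cases "z \<in> ball \<xi> 2 \<and> z \<noteq> \<xi>")
      case True
      define w where "w = cmod (\<xi> - z)"
      have w: "0 < w" "w < 2" using True by (auto simp: w_def dist_norm)
      \<comment> \<open>Minimality of k gives the upper bound w < 2 * 2^(-k); for k = 0 this is the
        assumption w < 2.\<close>
      define k where "k = (LEAST k. (1 / 2 :: real) ^ k \<le> w)"
      have "\<exists>k. (1 / 2 :: real) ^ k \<le> w"
        using real_arch_pow_inv[of w "1 / 2"] w by (auto intro: less_imp_le)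
      then have k: "(1 / 2 :: real) ^ k \<le> w" unfolding k_def by (rule LeastI_ex)
      have k': "w < 2 * (1 / 2) ^ k"
      proof (cases k)
        case (Suc j)
        have "\<not> (1 / 2 :: real) ^ j \<le> w" using not_less_Least[of j "\<lambda>k. (1 / 2 :: real) ^ k \<le> w"] Suc
          unfolding k_def by simp
        then show ?thesis using Suc by simp
      qed (use w in simp)
      have "w powr - s \<le> a k"
        unfolding a_def using k s by (intro powr_mono2') auto
      then have "ennreal (w powr - s) * indicator (ball \<xi> 2) z \<le> ?f k"
        using True k' by (auto simp: indicator_def w_def dist_norm intro: ennreal_leI)
      also have "\<dots> \<le> (\<Sum>k. ?f k)"
        by (rule le_suminf_ennreal)
      finally show ?thesis by (simp add: w_def)
    qed auto
  qed
  also have "\<dots> = (\<Sum>k. \<integral>\<^sup>+z. ennreal (a k) * indicator (ball \<xi> (2 * (1 / 2) ^ k)) z \<partial>lborel)"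
    by (intro nn_integral_suminf borel_measurable_times_ennreal borel_measurable_indicator) auto
  also have "\<dots> = (\<Sum>k. ennreal (4 * pi * q ^ k))"
  proof (rule suminf_cong)
    fix k
    have "(\<integral>\<^sup>+z. ennreal (a k) * indicator (ball \<xi> (2 * (1 / 2) ^ k)) z \<partial>lborel) =
        ennreal (a k) * ennreal (pi * (2 * (1 / 2) ^ k)\<^sup>2)"
      by (subst nn_integral_cmult_indicator) (auto simp: emeasure_ball eval_unit_ball_vol)
    also have "\<dots> = ennreal (a k * (pi * (2 * (1 / 2) ^ k)\<^sup>2))"
      by (intro ennreal_mult[symmetric]) (auto simp: a_def)
    finally show "(\<integral>\<^sup>+z. ennreal (a k) * indicator (ball \<xi> (2 * (1 / 2) ^ k)) z \<partial>lborel) = ennreal (4 * pi * q ^ k)"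
      unfolding a_eq .
  qed
  also have "\<dots> < \<infinity>"
    using q by (subst infinity_ennreal_def, intro top.not_eq_extremum[THEN iffD1] ennreal_suminf_neq_top summable_mult)
      (auto intro: summable_geometric)
  finally show ?thesis .
qed

text \<open>Through this inequality the weight cancels \<alpha> of the order of the singularity at
  \<xi>, up to the factor 2 that bounds 1 + |z|.\<close>

lemma one_minus_norm_le_dist:
  fixes z :: complex
  assumes "\<xi> \<in> sphere 0 1" "z \<in> \<D>"
  shows "1 - (cmod z)\<^sup>2 \<le> 2 * cmod (\<xi> - z)"
proof -
  have "1 - cmod z \<le> cmod (\<xi> - z)"
    using norm_triangle_ineq2[of \<xi> z] assms by simp
  then have "(1 - cmod z) * (1 + cmod z) \<le> cmod (\<xi> - z) * 2"
    using assms by (intro mult_mono) auto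
  then show ?thesis by (simp add: power2_eq_square algebra_simps)
qed

lemma measurable_dist_powr_dA:
  "\<xi> \<in> sphere 0 1 \<Longrightarrow> (\<lambda>z. cmod (\<xi> - z) powr e) \<in> borel_measurable (dA \<alpha>)"
  by (intro continuous_on_measurable_dA continuous_intros) auto

text \<open>The weight lowers the exponent from e to e - \<alpha>, which lies strictly between 0 and
  2, the range in which the singularity is integrable in the plane.\<close>

lemma integrable_dist_powr:
  assumes \<xi>: "\<xi> \<in> sphere 0 1" and \<alpha>: "\<alpha> \<ge> 0" and e: "\<alpha> < e" "e < 2 + \<alpha>"
  shows "integrable (dA \<alpha>) (\<lambda>z. cmod (\<xi> - z) powr - e)"
proof (rule integrableI_bounded)
  show meas: "(\<lambda>z. cmod (\<xi> - z) powr - e) \<in> borel_measurable (dA \<alpha>)"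
    using \<xi> by (rule measurable_dist_powr_dA)
  define C where "C = (1 + \<alpha>) * 2 powr \<alpha> / pi"
  have C: "C \<ge> 0" using \<alpha> by (simp add: C_def)
  have "(\<integral>\<^sup>+z. ennreal (norm (cmod (\<xi> - z) powr - e)) \<partial>dA \<alpha>) =
      (\<integral>\<^sup>+z\<in>\<D>. ennreal (bergman_weight \<alpha> z) * ennreal (cmod (\<xi> - z) powr - e) \<partial>lborel)"
    using meas by (subst nn_integral_dA[symmetric]) auto
  also have "\<dots> \<le> (\<integral>\<^sup>+z. ennreal C * (ennreal (cmod (\<xi> - z) powr - (e - \<alpha>)) * indicator (ball \<xi> 2) z) \<partial>lborel)"
  proof (intro nn_integral_mono)
    fix z
    show "ennreal (bergman_weight \<alpha> z) * ennreal (cmod (\<xi> - z) powr - e) * indicator \<D> z \<le>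
      ennreal C * (ennreal (cmod (\<xi> - z) powr - (e - \<alpha>)) * indicator (ball \<xi> 2) z)"
    proof (cases "z \<in> \<D>")
      case True
      have "cmod (\<xi> - z) < 2" using norm_triangle_ineq4[of \<xi> z] True \<xi> by simp
      then have zb: "z \<in> ball \<xi> 2" by (simp add: dist_norm)
      have "(1 - (cmod z)\<^sup>2) powr \<alpha> \<le> (2 * cmod (\<xi> - z)) powr \<alpha>"
        using one_minus_norm_le_dist[OF \<xi> True] True \<alpha> by (intro powr_mono2) (auto simp: power_le_one)
      also have "\<dots> = 2 powr \<alpha> * cmod (\<xi> - z) powr \<alpha>" by (simp add: powr_mult)
      finally have "bergman_weight \<alpha> z \<le> C * cmod (\<xi> - z) powr \<alpha>"
        unfolding bergman_weight_def C_def using \<alpha>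
        by (simp add: mult.assoc divide_right_mono mult_left_mono)
      then have "bergman_weight \<alpha> z * cmod (\<xi> - z) powr - e \<le>
          (C * cmod (\<xi> - z) powr \<alpha>) * cmod (\<xi> - z) powr - e"
        by (intro mult_right_mono) auto
      also have "\<dots> = C * cmod (\<xi> - z) powr - (e - \<alpha>)"
        by (simp add: mult.assoc powr_add[symmetric])
      finally show ?thesis
        using True zb C bergman_weight_nonneg[OF \<alpha>] by (simp add: ennreal_mult[symmetric])
    qed simp
  qed
  also have "\<dots> = ennreal C * (\<integral>\<^sup>+z\<in>ball \<xi> 2. ennreal (cmod (\<xi> - z) powr - (e - \<alpha>)) \<partial>lborel)"
    by (intro nn_integral_cmult borel_measurable_times_ennreal borel_measurable_indicator) auto
  also have "\<dots> < \<infinity>"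
    using nn_integral_singularity_finite[of "e - \<alpha>" \<xi>] e by (simp add: ennreal_mult_less_top)
  finally show "(\<integral>\<^sup>+z. ennreal (norm (cmod (\<xi> - z) powr - e)) \<partial>dA \<alpha>) < \<infinity>" .
qed

text \<open>The disjoint balls of centre \<open>(1 - 4\<^sup>-\<^sup>k) \<xi>\<close> and radius \<open>4\<^sup>-\<^sup>k / 2\<close>, for \<open>k < n\<close>, contribute
  about equally to the integral when \<open>e\<close> is close to \<open>2 + \<alpha>\<close>.\<close>

lemma nn_integral_dist_powr_ge:
  assumes \<xi>: "\<xi> \<in> sphere 0 1" and \<alpha>: "\<alpha> \<ge> 0" and e: "0 \<le> e" "e \<le> 2 + \<alpha>"
  shows "ennreal (real n * (2 powr - (2 * \<alpha> + 4)) * ((1 / 4) ^ n) powr (2 + \<alpha> - e)) \<le>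
    (\<integral>\<^sup>+z. ennreal (cmod (\<xi> - z) powr - e) \<partial>dA \<alpha>)"
proof -
  define q where "q k = (1 / 4 :: real) ^ k" for k :: nat
  have q: "0 < q k" "q k \<le> 1" for k by (simp_all add: q_def power_le_one)
  define B where "B k = ball (of_real (1 - q k) * \<xi>) (q k / 2)" for k
  \<comment> \<open>A lower bound on the ball \<open>B k\<close> for the density times the
    integrand: there 1 - |z| \<ge> \<open>q k / 2\<close> and |\<xi> - z| <
    \<open>2 * q k\<close>.\<close>
  define a where "a k = (q k / 2) powr \<alpha> * (2 * q k) powr - e / pi" for k
  have \<xi>n: "cmod \<xi> = 1" using \<xi> by simp
  have B: "z \<in> \<D>" "cmod (\<xi> - z) < 3 / 2 * q k" "q k / 2 < cmod (\<xi> - z)" "q k / 2 \<le> 1 - cmod z"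
    if "z \<in> B k" for z k
  proof -
    define b where "b = of_real (1 - q k) * \<xi> - z"
    have b: "cmod b < q k / 2" using that by (simp add: B_def b_def dist_norm)
    have eq: "\<xi> - z = b + of_real (q k) * \<xi>" by (simp add: b_def algebra_simps)
    have nq: "cmod (of_real (q k) * \<xi>) = q k" using q \<xi>n by (simp add: norm_mult less_imp_le)
    show "cmod (\<xi> - z) < 3 / 2 * q k"
      using norm_triangle_ineq[of b "of_real (q k) * \<xi>"] b unfolding eq nq by linarith
    show "q k / 2 < cmod (\<xi> - z)"
      using norm_diff_ineq[of "of_real (q k) * \<xi>" b] b unfolding eq nq by (simp add: add.commute)
    have "cmod (of_real (1 - q k) * \<xi>) = 1 - q k"
      unfolding norm_mult norm_of_real \<xi>n using q[of k] by simp
    then show "q k / 2 \<le> 1 - cmod z"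
      using norm_triangle_ineq2[of z "of_real (1 - q k) * \<xi>"] b
      unfolding b_def by (subst (asm) norm_minus_commute) linarith
    then show "z \<in> \<D>" using q[of k] by simp
  qed
  \<comment> \<open>The ratio 4 makes the balls disjoint: \<open>B k\<close> lies within 3/2
    \<open>q k\<close> \<le> 3/8 \<open>q j\<close> of \<xi>, while \<open>B j\<close> stays at
    distance more than \<open>q j / 2\<close>.\<close>
  have qlt: "q k \<le> q j / 4" if "j < k" for j k
  proof -
    have "q k \<le> q (Suc j)" unfolding q_def using that by (intro power_decreasing) auto
    then show ?thesis by (simp add: q_def)
  qed
  have disj: "j = k" if "z \<in> B j" "z \<in> B k" for z j k
  proof (rule ccontr)
    assume "j \<noteq> k"
    then consider "j < k" | "k < j" by linarith
    then show False
    proof cases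
      case 1 then show False using B[OF that(1)] B[OF that(2)] qlt[OF 1] q[of j] by linarith
    next
      case 2 then show False using B[OF that(1)] B[OF that(2)] qlt[OF 2] q[of k] by linarith
    qed
  qed
  have le: "a k \<le> bergman_weight \<alpha> z * cmod (\<xi> - z) powr - e" if z: "z \<in> B k" for z k
  proof -
    have "(cmod z)\<^sup>2 \<le> cmod z"
      using B(1)[OF z] by (simp add: power2_eq_square mult_left_le)
    then have "(q k / 2) powr \<alpha> \<le> (1 - (cmod z)\<^sup>2) powr \<alpha>"
      using B(4)[OF z] q[of k] \<alpha> by (intro powr_mono2) auto
    also have "\<dots> \<le> (1 + \<alpha>) * (1 - (cmod z)\<^sup>2) powr \<alpha>"
      using \<alpha> by (simp add: algebra_simps)
    finally have "(q k / 2) powr \<alpha> / pi \<le> bergman_weight \<alpha> z"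
      by (simp add: bergman_weight_def divide_right_mono)
    moreover have "(2 * q k) powr - e \<le> cmod (\<xi> - z) powr - e"
      using B(2,3)[OF z] q[of k] e by (intro powr_mono2') auto
    ultimately have "(q k / 2) powr \<alpha> / pi * (2 * q k) powr - e \<le> bergman_weight \<alpha> z * cmod (\<xi> - z) powr - e"
      using bergman_weight_nonneg[OF \<alpha>] by (intro mult_mono) auto
    then show ?thesis by (simp add: a_def)
  qed
  \<comment> \<open>The contribution of one ball is 2^(-(\<alpha> + e + 2)) times \<open>q k\<close>
    to the power 2 + \<alpha> - e. At the critical e this power is 1; below it, \<open>q k\<close>
    is replaced by the smaller 4^(-n).\<close>
  have vol: "a k * (pi * (q k / 2)\<^sup>2) \<ge> 2 powr - (2 * \<alpha> + 4) * ((1 / 4) ^ n) powr (2 + \<alpha> - e)" if "k < n" for k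
  proof -
    have "a k * (pi * (q k / 2)\<^sup>2) = (q k / 2) powr \<alpha> * (2 * q k) powr - e * (q k / 2) powr 2"
      using q[of k] by (simp add: a_def)
    also have "\<dots> = (q k powr \<alpha> * 2 powr - \<alpha>) * (2 powr - e * q k powr - e) * (q k powr 2 * 2 powr - 2)"
      using q[of k] by (simp add: powr_mult powr_divide powr_minus_divide)
    also have "\<dots> = (2 powr - \<alpha> * 2 powr - e * 2 powr - 2) * (q k powr \<alpha> * q k powr - e * q k powr 2)"
      by (simp only: mult_ac)
    also have "\<dots> = 2 powr - (\<alpha> + e + 2) * q k powr (2 + \<alpha> - e)"
    proof -
      have "2 powr - \<alpha> * 2 powr - e * 2 powr - 2 = (2::real) powr (- \<alpha> + - e + - 2)" by (simp only: powr_add)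
      moreover have "q k powr \<alpha> * q k powr - e * q k powr 2 = q k powr (\<alpha> + - e + 2)" by (simp only: powr_add)
      moreover have "- \<alpha> + - e + - 2 = - (\<alpha> + e + 2)" "\<alpha> + - e + 2 = 2 + \<alpha> - e" by simp_all
      ultimately show ?thesis by (simp only:)
    qed
    also have "\<dots> \<ge> 2 powr - (2 * \<alpha> + 4) * ((1 / 4) ^ n) powr (2 + \<alpha> - e)"
    proof (intro mult_mono powr_mono2 powr_mono)
      show "(1 / 4) ^ n \<le> q k" unfolding q_def using that by (intro power_decreasing) auto
    qed (use e in auto)
    finally show ?thesis .
  qed
  have [measurable]: "B k \<in> sets borel" for k by (simp add: B_def)
  have a0: "a k \<ge> 0" for k by (simp add: a_def)
  have "ennreal (real n * (2 powr - (2 * \<alpha> + 4)) * ((1 / 4) ^ n) powr (2 + \<alpha> - e)) \<le>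
      ennreal (\<Sum>k<n. a k * (pi * (q k / 2)\<^sup>2))"
    using sum_mono[of "{..<n}" "\<lambda>_. 2 powr - (2 * \<alpha> + 4) * ((1 / 4) ^ n) powr (2 + \<alpha> - e)" "\<lambda>k. a k * (pi * (q k / 2)\<^sup>2)"] vol
    by (intro ennreal_leI) (simp add: mult.assoc)
  also have "\<dots> = (\<Sum>k<n. ennreal (a k) * emeasure lborel (B k))"
  proof -
    have "emeasure lborel (B k) = ennreal (pi * (q k / 2)\<^sup>2)" for k
      unfolding B_def using q[of k] by (subst emeasure_ball) (auto simp: eval_unit_ball_vol)
    then show ?thesis using a0 by (simp add: ennreal_mult[symmetric] sum_ennreal)
  qed
  also have "\<dots> = (\<integral>\<^sup>+z. (\<Sum>k<n. ennreal (a k) * indicator (B k) z) \<partial>lborel)"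
    by (subst nn_integral_sum) (auto simp: nn_integral_cmult_indicator)
  also have "\<dots> \<le> (\<integral>\<^sup>+z\<in>\<D>. ennreal (bergman_weight \<alpha> z) * ennreal (cmod (\<xi> - z) powr - e) \<partial>lborel)"
  proof (intro nn_integral_mono)
    fix z
    show "(\<Sum>k<n. ennreal (a k) * indicator (B k) z) \<le>
      ennreal (bergman_weight \<alpha> z) * ennreal (cmod (\<xi> - z) powr - e) * indicator \<D> z"
    proof (cases "\<exists>k<n. z \<in> B k")
      case True
      then obtain k where k: "k < n" "z \<in> B k" by blast
      have "ennreal (a j) * indicator (B j) z = (if j = k then ennreal (a k) else 0)" for j
      proof (cases "j = k")
        case False
        then have "z \<notin> B j" using disj k(2) by blast
        then show ?thesis using False by simp
      qed (use k(2) in simp)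
      then have "(\<Sum>k<n. ennreal (a k) * indicator (B k) z) = (\<Sum>j<n. if j = k then ennreal (a k) else 0)"
        by (intro sum.cong refl)
      also have "\<dots> = ennreal (a k)" using k by simp
      finally show ?thesis
        using le[OF k(2)] B(1)[OF k(2)] bergman_weight_nonneg[OF \<alpha>]
        by (simp add: ennreal_mult[symmetric] ennreal_leI)
    next
      case False
      then have "(\<Sum>k<n. ennreal (a k) * indicator (B k) z) = 0"
        by (intro sum.neutral ballI) simp
      then show ?thesis by simp
    qed
  qed
  also have "\<dots> = (\<integral>\<^sup>+z. ennreal (cmod (\<xi> - z) powr - e) \<partial>dA \<alpha>)"
    using measurable_dist_powr_dA[OF \<xi>] by (subst nn_integral_dA) auto
  finally show ?thesis .
qed

text \<open>For fixed n the lower bound tends to n times a positive constant as e increases to 2 +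
  \<alpha>. Choosing n from M first, and then e close to the limit, exceeds any M.\<close>

lemma integral_dist_powr_at_top:
  assumes \<xi>: "\<xi> \<in> sphere 0 1" and \<alpha>: "\<alpha> \<ge> 0"
  shows "filterlim (\<lambda>e. LINT z|dA \<alpha>. cmod (\<xi> - z) powr - e) at_top (at_left (2 + \<alpha>))"
  unfolding filterlim_at_top
proof
  fix M :: real
  define \<kappa> :: real where "\<kappa> = 2 powr - (2 * \<alpha> + 4)"
  have \<kappa>: "\<kappa> > 0" by (simp add: \<kappa>_def)
  obtain n :: nat where "real n > (\<bar>M\<bar> + 1) / \<kappa>" using reals_Archimedean2 by blast
  then have n: "\<bar>M\<bar> + 1 < real n * \<kappa>" using \<kappa> by (simp add: field_simps)
  have "((\<lambda>e. real n * \<kappa> * ((1 / 4) ^ n) powr (2 + \<alpha> - e)) \<longlongrightarrow> real n * \<kappa> * ((1 / 4) ^ n) powr (2 + \<alpha> - (2 + \<alpha>)))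
      (at_left (2 + \<alpha>))"
    by (intro tendsto_intros) auto
  then have "\<forall>\<^sub>F e in at_left (2 + \<alpha>). \<bar>M\<bar> < real n * \<kappa> * ((1 / 4) ^ n) powr (2 + \<alpha> - e)"
    using n by (intro order_tendstoD) auto
  moreover have "\<forall>\<^sub>F e in at_left (2 + \<alpha>). e \<in> {\<alpha><..<2 + \<alpha>}"
    by (intro eventually_at_left_real) simp
  ultimately show "\<forall>\<^sub>F e in at_left (2 + \<alpha>). M \<le> (LINT z|dA \<alpha>. cmod (\<xi> - z) powr - e)"
  proof eventually_elim
    case (elim e)
    have "ennreal (real n * \<kappa> * ((1 / 4) ^ n) powr (2 + \<alpha> - e)) \<le> ennreal (LINT z|dA \<alpha>. cmod (\<xi> - z) powr - e)"
      using nn_integral_dist_powr_ge[OF \<xi> \<alpha>, of e n] integrable_dist_powr[OF \<xi> \<alpha>, of e] elim \<alpha>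
      by (simp add: \<kappa>_def nn_integral_eq_integral)
    then have "real n * \<kappa> * ((1 / 4) ^ n) powr (2 + \<alpha> - e) \<le> (LINT z|dA \<alpha>. cmod (\<xi> - z) powr - e)"
      by (subst (asm) ennreal_le_iff) (auto intro: Bochner_Integration.integral_nonneg)
    then show ?case using elim by linarith
  qed
qed

text \<open>As c is real, only the real part of the logarithm matters, and this is ln |\<xi> - z|
  for every branch.\<close>

lemma norm_test_fun_hat:
  assumes "\<xi> \<in> sphere 0 1" "z \<in> \<D>"
  shows "cmod (test_fun_hat c \<xi> z) = cmod (\<xi> - z) powr - c"
proof -
  have ne: "cmod (\<xi> - z) > 0" using assms by auto
  have "cmod (\<xi> - z) = exp (Re (log_branch \<xi> z))"
    using exp_log_branch[OF assms] by (metis norm_exp_eq_Re)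
  then have "Re (log_branch \<xi> z) = ln (cmod (\<xi> - z))" by simp
  then show ?thesis using ne by (simp add: test_fun_hat_def norm_exp_eq_Re powr_def)
qed

lemma test_fun_hat_bergman:
  assumes \<xi>: "\<xi> \<in> sphere 0 1" and \<alpha>: "\<alpha> \<ge> 0" and c: "\<alpha> < c * p" "c * p < 2 + \<alpha>"
  shows "test_fun_hat c \<xi> \<in> bergman p \<alpha>"
proof -
  have "test_fun_hat c \<xi> holomorphic_on \<D>"
    unfolding test_fun_hat_def[abs_def]
    by (intro holomorphic_intros holomorphic_log_branch[OF \<xi>])
  moreover have "integrable (dA \<alpha>) (\<lambda>z. cmod (test_fun_hat c \<xi> z) powr p) \<longleftrightarrow>
      integrable (dA \<alpha>) (\<lambda>z. cmod (\<xi> - z) powr - (c * p))"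
    by (intro Bochner_Integration.integrable_cong) (auto simp: norm_test_fun_hat[OF \<xi>] powr_powr)
  ultimately show ?thesis
    using integrable_dist_powr[OF \<xi> \<alpha> c] by (simp add: bergman_def)
qed

subsection \<open>Limit of the test functions\<close>

text \<open>Pull the normalising constant out of the norm. The formula holds for every c: a
  divergent integral has the default value 0, and division by 0 gives 0 on both sides.\<close>

lemma bergman_norm_test_fun:
  assumes p: "p > 1" and \<alpha>: "\<alpha> \<ge> 0" and \<xi>: "\<xi> \<in> sphere 0 1"
    and maps: "\<And>z. z \<in> \<D> \<Longrightarrow> \<phi> z \<in> \<D>"
  shows "bergman_norm p \<alpha> (wcomp u \<phi> (test_fun p \<alpha> c \<xi>)) =
    ((LINT z|dA \<alpha>. cmod (u z) powr p * cmod (\<xi> - \<phi> z) powr - (c * p)) /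
     (LINT z|dA \<alpha>. cmod (\<xi> - z) powr - (c * p))) powr (1 / p)"
proof -
  let ?N = "bergman_norm p \<alpha> (test_fun_hat c \<xi>)"
  have N: "?N = (LINT z|dA \<alpha>. cmod (\<xi> - z) powr - (c * p)) powr (1 / p)"
    unfolding bergman_norm_def using \<xi>
    by (intro arg_cong[where f="\<lambda>x. x powr (1 / p)"] Bochner_Integration.integral_cong)
      (auto simp: norm_test_fun_hat powr_powr)
  have J: "bergman_norm p \<alpha> (wcomp u \<phi> (test_fun_hat c \<xi>)) =
      (LINT z|dA \<alpha>. cmod (u z) powr p * cmod (\<xi> - \<phi> z) powr - (c * p)) powr (1 / p)"
    unfolding bergman_norm_def wcomp_def using \<xi> maps
    by (intro arg_cong[where f="\<lambda>x. x powr (1 / p)"] Bochner_Integration.integral_cong)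
      (auto simp: norm_test_fun_hat powr_powr norm_mult powr_mult)
  have "bergman_norm p \<alpha> (wcomp u \<phi> (test_fun p \<alpha> c \<xi>)) =
      bergman_norm p \<alpha> (\<lambda>z. of_real (1 / ?N) * wcomp u \<phi> (test_fun_hat c \<xi>) z)"
    by (simp add: wcomp_def test_fun_def mult_ac)
  also have "\<dots> = bergman_norm p \<alpha> (wcomp u \<phi> (test_fun_hat c \<xi>)) / ?N"
    using p bergman_norm_nonneg[of p \<alpha> "test_fun_hat c \<xi>"] by (subst bergman_norm_cmult) (auto simp: norm_divide)
  finally show ?thesis
    unfolding N J by (simp add: powr_divide Bochner_Integration.integral_nonneg)
qed

context boundary_fixed
begin

text \<open>Near \<xi> the integrands have a ratio close to the constant, which yields the term with
  \<eta>. Elsewhere both are bounded independently of e, which yields C. That C does not depend on e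
  lets the divergent integral absorb it.\<close>

lemma test_integral_diff_le:
  assumes d0: "Re d > 0" and p: "p > 1" and \<alpha>: "\<alpha> \<ge> 0"
    and u: "u \<in> bergman p \<alpha>" and u0: "(u \<longlongrightarrow> u0) (at \<xi> within \<D>)"
    and op: "wcomp u \<phi> \<in> bergman_ops p \<alpha>"
    and away: "\<And>\<epsilon>. \<epsilon> > 0 \<Longrightarrow> closure (\<phi> ` (\<D> - ball \<xi> \<epsilon>)) \<inter> sphere 0 1 = {}"
    and \<eta>: "\<eta> > 0"
  shows "\<exists>C. \<forall>\<^sub>F e in at_left (2 + \<alpha>).
    \<bar>(LINT z|dA \<alpha>. cmod (u z) powr p * cmod (\<xi> - \<phi> z) powr - e) -
      cmod u0 powr p * Re d powr - (2 + \<alpha>) * (LINT z|dA \<alpha>. cmod (\<xi> - z) powr - e)\<bar> \<le>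
    \<eta> * (LINT z|dA \<alpha>. cmod (\<xi> - z) powr - e) + C"
proof -
  define A where "A = cmod u0 powr p * Re d powr - (2 + \<alpha>)"
  have A0: "A \<ge> 0" by (simp add: A_def)
  have dnorm: "cmod d = Re d"
    using derivative_real_nonneg by (simp add: cmod_def)
  \<comment> \<open>The ratio of the two integrands. Its limit is taken jointly in z and e, since
    the neighbourhood of \<xi> must not depend on e.\<close>
  let ?F = "\<lambda>(z, e). cmod (u z) powr p * (cmod (\<xi> - \<phi> z) / cmod (\<xi> - z)) powr - e"
  have "((\<lambda>x. cmod (u (fst x)) powr p * (cmod (\<xi> - \<phi> (fst x)) / cmod (\<xi> - fst x)) powr - (snd x)) \<longlongrightarrow>
      cmod u0 powr p * cmod d powr - (2 + \<alpha>)) ((at \<xi> within \<D>) \<times>\<^sub>F at_left (2 + \<alpha>))"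
  proof (intro tendsto_mult tendsto_powr' tendsto_powr tendsto_norm tendsto_minus tendsto_const)
    show "LIM x (at \<xi> within \<D>) \<times>\<^sub>F at_left (2 + \<alpha>). u (fst x) :> nhds u0"
      using filterlim_compose[OF u0 filterlim_fst] .
    show "LIM x (at \<xi> within \<D>) \<times>\<^sub>F at_left (2 + \<alpha>). cmod (\<xi> - \<phi> (fst x)) / cmod (\<xi> - fst x) :> nhds (cmod d)"
      using filterlim_compose[OF difference_quotient_tendsto filterlim_fst] .
    have "LIM x (at \<xi> within \<D>) \<times>\<^sub>F at_left (2 + \<alpha>). snd x :> at_left (2 + \<alpha>)"
      by (rule filterlim_snd)
    then show "LIM x (at \<xi> within \<D>) \<times>\<^sub>F at_left (2 + \<alpha>). snd x :> nhds (2 + \<alpha>)"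
      by (rule filterlim_mono) (auto simp: at_within_le_nhds)
  qed (use d0 dnorm p in auto)
  then have "\<forall>\<^sub>F x in (at \<xi> within \<D>) \<times>\<^sub>F at_left (2 + \<alpha>). dist (?F x) A < \<eta>"
    using \<eta> unfolding A_def dnorm by (auto dest!: tendstoD simp: case_prod_beta)
  then obtain P Q where P: "eventually P (at \<xi> within \<D>)" and Q: "eventually Q (at_left (2 + \<alpha>))"
    and PQ: "\<And>z e. P z \<Longrightarrow> Q e \<Longrightarrow> dist (?F (z, e)) A < \<eta>"
    unfolding eventually_prod_filter by blast
  obtain \<delta>' where \<delta>': "\<delta>' > 0" "\<And>z. z \<in> \<D> \<inter> ball \<xi> \<delta>' \<Longrightarrow> P z"
    using P unfolding eventually_at_within_disk[OF \<xi>] by blast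
  \<comment> \<open>Capping at 1 allows |\<xi> - z|^(-e) outside the ball to be bounded by
    \<delta>^(-(2 + \<alpha>)), free of e.\<close>
  define \<delta> where "\<delta> = min \<delta>' 1"
  have \<delta>: "\<delta> > 0" "\<delta> \<le> 1" "\<And>z. z \<in> \<D> \<inter> ball \<xi> \<delta> \<Longrightarrow> P z"
    using \<delta>' by (auto simp: \<delta>_def)
  obtain \<rho> where \<rho>: "0 \<le> \<rho>" "\<rho> < 1" "\<phi> ` (\<D> - ball \<xi> \<delta>) \<subseteq> cball 0 \<rho>"
    using closure_avoiding_sphere[of "\<phi> ` (\<D> - ball \<xi> \<delta>)"] maps away[OF \<delta>(1)] by blast
  define C1 C2 where "C1 = (1 - \<rho>) powr - (2 + \<alpha>)" and "C2 = A * \<delta> powr - (2 + \<alpha>)"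
  have C: "C1 \<ge> 0" "C2 \<ge> 0" using A0 by (simp_all add: C1_def C2_def)
  have powr_le: "y powr - e \<le> x powr - (2 + \<alpha>)" if "0 < x" "x \<le> 1" "x \<le> y" "0 < e" "e < 2 + \<alpha>" for x y e
  proof -
    have "y powr - e \<le> x powr - e" using that by (intro powr_mono2') auto
    also have "\<dots> \<le> x powr - (2 + \<alpha>)" using that by (intro powr_mono') auto
    finally show ?thesis .
  qed
  \<comment> \<open>The total mass is finite because |\<xi> - z| \<le> 2 bounds an integrable power
    from below; 1 + \<alpha> is the middle of the range of integrable exponents proved
    above.\<close>
  have int_1: "integrable (dA \<alpha>) (\<lambda>_. 1 :: real)"
  proof (rule Bochner_Integration.integrable_bound)
    show "integrable (dA \<alpha>) (\<lambda>z. 2 powr (1 + \<alpha>) * cmod (\<xi> - z) powr - (1 + \<alpha>))"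
      using integrable_dist_powr[OF \<xi> \<alpha>, of "1 + \<alpha>"] by simp
    show "AE z in dA \<alpha>. norm (1 :: real) \<le> norm (2 powr (1 + \<alpha>) * cmod (\<xi> - z) powr - (1 + \<alpha>))"
    proof (rule AE_I2)
      fix z assume "z \<in> space (dA \<alpha>)"
      then have z: "0 < cmod (\<xi> - z)" "cmod (\<xi> - z) \<le> 2"
        using \<xi> norm_triangle_ineq4[of \<xi> z] by auto
      have "1 = (2::real) powr (1 + \<alpha>) * 2 powr - (1 + \<alpha>)" by (simp add: powr_add[symmetric])
      also have "\<dots> \<le> 2 powr (1 + \<alpha>) * cmod (\<xi> - z) powr - (1 + \<alpha>)"
        using z \<alpha> by (intro mult_left_mono powr_mono2') auto
      finally show "norm (1 :: real) \<le> norm (2 powr (1 + \<alpha>) * cmod (\<xi> - z) powr - (1 + \<alpha>))" by simp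
    qed
  qed simp
  define C where "C = C1 * (LINT z|dA \<alpha>. cmod (u z) powr p) + C2 * (LINT z|dA \<alpha>. 1)"
  have "\<forall>\<^sub>F e in at_left (2 + \<alpha>). e \<in> {\<alpha><..<2 + \<alpha>}"
    by (intro eventually_at_left_real) simp
  with Q have "\<forall>\<^sub>F e in at_left (2 + \<alpha>).
    \<bar>(LINT z|dA \<alpha>. cmod (u z) powr p * cmod (\<xi> - \<phi> z) powr - e) - A * (LINT z|dA \<alpha>. cmod (\<xi> - z) powr - e)\<bar>
      \<le> \<eta> * (LINT z|dA \<alpha>. cmod (\<xi> - z) powr - e) + C"
  proof eventually_elim
    case (elim e)
    have e: "\<alpha> < e" "e < 2 + \<alpha>" "0 < e" using elim \<alpha> by auto
    let ?G = "\<lambda>z. cmod (u z) powr p * cmod (\<xi> - \<phi> z) powr - e"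
    let ?H = "\<lambda>z. cmod (\<xi> - z) powr - e"
    have H: "integrable (dA \<alpha>) ?H" using e by (intro integrable_dist_powr \<xi> \<alpha>)
    \<comment> \<open>This integral is the p-th power of the norm of the image of the unnormalised
      test function with c = e/p, and the operator maps the space into itself.\<close>
    have G: "integrable (dA \<alpha>) ?G"
    proof -
      have "test_fun_hat (e / p) \<xi> \<in> bergman p \<alpha>"
        using e p by (intro test_fun_hat_bergman \<xi> \<alpha>) auto
      from wcomp_bergman[OF op this]
      have "integrable (dA \<alpha>) (\<lambda>z. cmod (wcomp u \<phi> (test_fun_hat (e / p) \<xi>) z) powr p)"
        by (rule bergmanD)
      also have "?this \<longleftrightarrow> integrable (dA \<alpha>) ?G"
        using maps p by (intro Bochner_Integration.integrable_cong)
          (auto simp: wcomp_def norm_mult powr_mult norm_test_fun_hat[OF \<xi>] powr_powr)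
      finally show ?thesis .
    qed
    have U: "integrable (dA \<alpha>) (\<lambda>z. cmod (u z) powr p)" using u by (rule bergmanD)
    have pointwise: "\<bar>?G z - A * ?H z\<bar> \<le> \<eta> * ?H z + C1 * cmod (u z) powr p + C2" if z: "z \<in> \<D>" for z
    proof (cases "z \<in> ball \<xi> \<delta>")
      case True
      have ne: "cmod (\<xi> - z) > 0" using z \<xi> by auto
      have "?G z = ?F (z, e) * ?H z"
        using ne by (simp add: powr_divide)
      then have "?G z - A * ?H z = (?F (z, e) - A) * ?H z"
        by (simp only: left_diff_distrib)
      then have "\<bar>?G z - A * ?H z\<bar> = dist (?F (z, e)) A * ?H z"
        by (simp only: abs_mult dist_real_def abs_of_nonneg[OF powr_ge_zero])
      also have "\<dots> \<le> \<eta> * ?H z"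
        using PQ[OF \<delta>(3) elim(1), of z] z True by (intro mult_right_mono) auto
      finally show ?thesis using C by (simp add: add_nonneg_nonneg add_increasing2)
    next
      case False
      have "cmod (\<phi> z) \<le> \<rho>" using \<rho>(3) z False by (auto simp: image_subset_iff)
      then have "1 - \<rho> \<le> cmod (\<xi> - \<phi> z)"
        using norm_triangle_ineq2[of \<xi> "\<phi> z"] \<xi>_norm by linarith
      then have "cmod (\<xi> - \<phi> z) powr - e \<le> C1"
        unfolding C1_def using \<rho> e by (intro powr_le) auto
      then have g: "?G z \<le> C1 * cmod (u z) powr p"
        by (subst mult.commute) (intro mult_right_mono, auto)
      have "cmod (\<xi> - z) powr - e \<le> \<delta> powr - (2 + \<alpha>)"
        using False \<delta> e by (intro powr_le) (auto simp: dist_norm)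
      then have h: "A * ?H z \<le> C2" unfolding C2_def using A0 by (intro mult_left_mono)
      have "0 \<le> ?G z" "0 \<le> A * ?H z" "0 \<le> \<eta> * ?H z" using A0 \<eta> by simp_all
      then show ?thesis using g h by linarith
    qed
    have "(LINT z|dA \<alpha>. ?G z) - A * (LINT z|dA \<alpha>. ?H z) = (LINT z|dA \<alpha>. ?G z - A * ?H z)"
      using G H by simp
    then have "\<bar>(LINT z|dA \<alpha>. ?G z) - A * (LINT z|dA \<alpha>. ?H z)\<bar> \<le> (LINT z|dA \<alpha>. \<bar>?G z - A * ?H z\<bar>)"
      by (simp only: integral_abs_bound)
    also have "\<dots> \<le> (LINT z|dA \<alpha>. \<eta> * ?H z + C1 * cmod (u z) powr p + C2 * 1)"
      using pointwise G H U int_1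
      by (intro integral_mono integrable_abs Bochner_Integration.integrable_add
          Bochner_Integration.integrable_diff integrable_mult_right) auto
    also have "\<dots> = \<eta> * (LINT z|dA \<alpha>. ?H z) + C"
    proof -
      have ints: "integrable (dA \<alpha>) (\<lambda>z. \<eta> * ?H z)" "integrable (dA \<alpha>) (\<lambda>z. C1 * cmod (u z) powr p)"
        "integrable (dA \<alpha>) (\<lambda>z. C2 * 1)"
        by (intro integrable_mult_right H U int_1)+
      show ?thesis
        unfolding C_def Bochner_Integration.integral_add[OF Bochner_Integration.integrable_add[OF ints(1,2)] ints(3)]
          Bochner_Integration.integral_add[OF ints(1,2)] integral_mult_right_zero by simp
    qed
    finally show ?case .
  qed
  then show ?thesis unfolding A_def by blast
qed

text \<open>Dividing the estimate for the difference by the divergent integral leaves an error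
  \<eta> plus a term tending to 0. The substitution e = cp and the p-th root then turn the quotient
  of integrals into the norm.\<close>

lemma test_fun_norm_tendsto:
  assumes d0: "Re d > 0" and p: "p > 1" and \<alpha>: "\<alpha> \<ge> 0"
    and u: "u \<in> bergman p \<alpha>" and u0: "(u \<longlongrightarrow> u0) (at \<xi> within \<D>)"
    and op: "wcomp u \<phi> \<in> bergman_ops p \<alpha>"
    and away: "\<And>\<epsilon>. \<epsilon> > 0 \<Longrightarrow> closure (\<phi> ` (\<D> - ball \<xi> \<epsilon>)) \<inter> sphere 0 1 = {}"
  shows "((\<lambda>c. bergman_norm p \<alpha> (wcomp u \<phi> (test_fun p \<alpha> c \<xi>))) \<longlongrightarrow>
    cmod u0 * Re d powr - ((2 + \<alpha>) / p)) (at_left ((2 + \<alpha>) / p))"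
proof -
  let ?J = "\<lambda>e. LINT z|dA \<alpha>. cmod (u z) powr p * cmod (\<xi> - \<phi> z) powr - e"
  let ?N = "\<lambda>e. LINT z|dA \<alpha>. cmod (\<xi> - z) powr - e"
  define A where "A = cmod u0 powr p * Re d powr - (2 + \<alpha>)"
  have top: "filterlim ?N at_top (at_left (2 + \<alpha>))"
    by (rule integral_dist_powr_at_top[OF \<xi> \<alpha>])
  have lim: "((\<lambda>e. ?J e / ?N e) \<longlongrightarrow> A) (at_left (2 + \<alpha>))"
  proof (rule tendstoI)
    fix \<epsilon> :: real assume \<epsilon>: "\<epsilon> > 0"
    obtain C where C: "\<forall>\<^sub>F e in at_left (2 + \<alpha>). \<bar>?J e - A * ?N e\<bar> \<le> \<epsilon> / 2 * ?N e + C"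
      using test_integral_diff_le[OF d0 p \<alpha> u u0 op away, of "\<epsilon> / 2"] \<epsilon> unfolding A_def by auto
    have "\<forall>\<^sub>F e in at_left (2 + \<alpha>). max 0 (2 * C / \<epsilon>) < ?N e"
      using top unfolding filterlim_at_top_dense by blast
    with C show "\<forall>\<^sub>F e in at_left (2 + \<alpha>). dist (?J e / ?N e) A < \<epsilon>"
    proof eventually_elim
      case (elim e)
      \<comment> \<open>The threshold 2C/\<epsilon> makes the constant C cost less than \<epsilon>/2
        after division; the maximum with 0 makes the divisor positive.\<close>
      have N: "?N e > 0" "C < \<epsilon> / 2 * ?N e" using elim(2) \<epsilon> by (auto simp: field_simps)
      have "dist (?J e / ?N e) A = \<bar>?J e - A * ?N e\<bar> / ?N e"
      proof -
        have "?J e / ?N e - A = (?J e - A * ?N e) / ?N e"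
          using N(1) by (simp add: diff_divide_distrib)
        then show ?thesis using N(1) by (simp add: dist_real_def)
      qed
      also have "\<dots> < \<epsilon>"
        using elim(1) N by (subst pos_divide_less_eq) auto
      finally show ?case .
    qed
  qed
  have scale: "filterlim (\<lambda>c. c * p) (at_left (2 + \<alpha>)) (at_left ((2 + \<alpha>) / p))"
    unfolding filterlim_at
  proof
    have "((\<lambda>c. c * p) \<longlongrightarrow> (2 + \<alpha>) / p * p) (at_left ((2 + \<alpha>) / p))"
      by (intro tendsto_intros)
    then show "((\<lambda>c. c * p) \<longlongrightarrow> 2 + \<alpha>) (at_left ((2 + \<alpha>) / p))" using p by simp
    have "\<forall>\<^sub>F c in at_left ((2 + \<alpha>) / p). c < (2 + \<alpha>) / p"
      by (auto simp: eventually_at_filter)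
    then show "\<forall>\<^sub>F c in at_left ((2 + \<alpha>) / p). c * p \<in> {..<2 + \<alpha>} \<and> c * p \<noteq> 2 + \<alpha>"
      using p by (elim eventually_mono) (auto simp: field_simps)
  qed
  have "((\<lambda>c. (?J (c * p) / ?N (c * p)) powr (1 / p)) \<longlongrightarrow> A powr (1 / p)) (at_left ((2 + \<alpha>) / p))"
    using filterlim_compose[OF lim scale] p
    by (intro tendsto_powr' tendsto_const)
      (auto intro!: always_eventually divide_nonneg_nonneg Bochner_Integration.integral_nonneg)
  moreover have "A powr (1 / p) = cmod u0 * Re d powr - ((2 + \<alpha>) / p)"
  proof -
    have "- (2 + \<alpha>) * (1 / p) = - ((2 + \<alpha>) / p)"
      by (simp only: minus_divide_left times_divide_eq_right mult_1_right)
    then have "(Re d powr - (2 + \<alpha>)) powr (1 / p) = Re d powr - ((2 + \<alpha>) / p)"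
      by (simp only: powr_powr)
    moreover have "(cmod u0 powr p) powr (1 / p) = cmod u0" using p by (simp add: powr_powr)
    ultimately show ?thesis by (simp only: A_def powr_mult)
  qed
  ultimately show ?thesis
    using bergman_norm_test_fun[OF p \<alpha> \<xi> maps] by simp
qed

end

text \<open>The limit along sequences is expressed by \<open>at_left\<close>, and its existence is
  part of the conclusion. The supremum is formed in \<open>ereal\<close>, where it and the limsup
  exist without a prior bound.\<close>

theorem proposition2p7:
  fixes p \<alpha> :: real and \<xi> :: complex and u \<phi> :: "real \<Rightarrow> complex \<Rightarrow> complex" and t :: real
  assumes "p > 1" and "\<alpha> \<ge> 0" and "\<xi> \<in> sphere 0 1"
    and "admissible_family p \<alpha> \<xi> u \<phi>"
    and "t \<in> {0<..<1}"
  shows "\<exists>L. ((\<lambda>c. bergman_norm p \<alpha> (wcomp (u t) (\<phi> t) (test_fun p \<alpha> c \<xi>))) \<longlongrightarrow> L)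
                (at_left ((2 + \<alpha>) / p)) \<and>
             (SUP f\<in>weakly_null_unit_seqs p \<alpha>.
                limsup (\<lambda>n. ereal (bergman_norm p \<alpha> (wcomp (u t) (\<phi> t) (f n))))) \<le> ereal L"
proof -
  note adm = assms(4)[unfolded admissible_family_def]
  have sym: "\<phi> t holomorphic_on \<D>" "\<phi> t ` \<D> \<subseteq> \<D>" "u t \<in> bergman p \<alpha>"
    "wcomp (u t) (\<phi> t) \<in> bergman_ops p \<alpha>"
    using adm assms(5) by auto
  have dir: "extends_continuously_near \<xi> (deriv (\<phi> t))" "(\<phi> t \<longlongrightarrow> \<xi>) (at \<xi> within \<D>)"
    "\<And>\<epsilon>. \<epsilon> > 0 \<Longrightarrow> closure (\<phi> t ` (\<D> - ball \<xi> \<epsilon>)) \<inter> sphere 0 1 = {}"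
    "extends_continuously_near \<xi> (u t)"
    using adm assms(5) unfolding has_direction_def by auto
  obtain d where d: "(deriv (\<phi> t) \<longlongrightarrow> d) (at \<xi> within \<D>)"
    using extends_continuously_near_tendsto[OF assms(3) dir(1)] .
  obtain u0 where u0: "(u t \<longlongrightarrow> u0) (at \<xi> within \<D>)"
    using extends_continuously_near_tendsto[OF assms(3) dir(4)] .
  interpret boundary_fixed \<xi> "\<phi> t" d
    using assms(3) sym(1,2) dir(2) d by unfold_locales (auto simp: image_subset_iff)
  \<comment> \<open>The lower bound for the derivatives, taken at the parameter t itself, passes to
    the limit at \<xi>. It excludes d = 0, and d is already known to be real and
    nonnegative.\<close>
  have "\<exists>\<epsilon>>0. \<exists>m>0. \<forall>s\<in>{0<..<1}. \<bar>s - t\<bar> < \<epsilon> \<longrightarrow>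
      (\<forall>z\<in>ball \<xi> \<epsilon> \<inter> \<D>. m \<le> cmod (deriv (\<phi> s) z))"
    using adm assms(5) by blast
  then obtain \<epsilon> m where m: "\<epsilon> > 0" "m > 0" "\<And>z. z \<in> ball \<xi> \<epsilon> \<inter> \<D> \<Longrightarrow> m \<le> cmod (deriv (\<phi> t) z)"
    using assms(5) by (metis abs_zero diff_self)
  have "m \<le> cmod d"
  proof (rule tendsto_lowerbound[OF tendsto_norm[OF d]])
    show "\<forall>\<^sub>F z in at \<xi> within \<D>. m \<le> cmod (deriv (\<phi> t) z)"
      using m by (auto simp: eventually_at_within_disk[OF assms(3)] intro!: exI[of _ \<epsilon>])
  qed simp
  then have "d \<noteq> 0" using m(2) by auto
  then have d0: "Re d > 0"
    using derivative_real_nonneg by (auto simp: less_le complex_eq_iff)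
  show ?thesis
    using test_fun_norm_tendsto[OF d0 assms(1,2) sym(3) u0 sym(4) dir(3)]
      weakly_null_limsup_le[OF d0 assms(1,2) sym(3) u0 sym(4) dir(3)]
    by (intro exI conjI SUP_least)
qed

end
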